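(* Let $[u]$ be a constant (nonzero) multiple of $\sin(\pi u/\omega_1)$ ($\rho=2$) or of $u$ ($\rho=1$). Let $\delta,\kappa\in\mathbb{C}$ with $\delta,\kappa,\kappa-\delta\notin\Omega$, $\mu=(\mu_1,\dots,\mu_{2\rho})\in\mathbb{C}^{2\rho}$, let $m,n\ge0$ be integers, and let $x=(x_1,\dots,x_m)$, $y=(y_1,\dots,y_n)$. (1) Let $G(u|\delta)$ be a nonzero meromorphic function with $G(u+\delta|\delta)=c_0\,[u]\,G(u|\delta)$ for some nonzero constant $c_0$, and let $\Phi_{BC}(x;y|\delta,\kappa)$ be either of the two functions $$\prod_{j=1}^{m}\prod_{l=1}^{n}\frac{G(x_j\pm y_l+\frac12(\delta-\kappa)|\delta)}{G(x_j\pm y_l+\frac12(\delta+\kappa)|\delta)}\qquad\text{or}\qquad \prod_{j=1}^{m}\prod_{l=1}^{n}\prod_{\epsilon_1,\epsilon_2=\pm}G(\epsilon_1x_j+\epsilon_2y_l+\tfrac12(\delta-\kappa)|\delta).$$ Then $$[\kappa]E_x^{(\mu|\delta,\kappa)}\Phi_{BC}(x;y|\delta,\kappa)-[\kappa]E_y^{(\nu|\delta,\kappa)}\Phi_{BC}(x;y|\delta,\kappa)=\big[2(m-n)\kappa+c^{(\mu|\delta,\kappa)}\big]\Phi_{BC}(x;y|\delta,\kappa),$$ where $\nu_r=\frac12(\delta+\kappa)-\mu_r$ $(r=1,\dots,2\rho)$. (2) The function $\Psi_{BC}(x;y)=\prod_{j=1}^{m}\prod_{l=1}^{n}[x_j\pm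 y_l]$ satisfies $$[\kappa]E_x^{(\mu|\delta,\kappa)}\Psi_{BC}(x;y)+[\delta]E_y^{(\mu|\kappa,\delta)}\Psi_{BC}(x;y)=\big[2m\kappa+2n\delta+c^{(\mu|\delta,\kappa)}\big]\Psi_{BC}(x;y).$$
   Context: Notation: $\Omega$ is the zero set of $[u]$: $\Omega=\mathbb{Z}\omega_1$ with $\omega_1\ne0$ in the trigonometric case ($\rho=2$), where one also puts $\omega_2=0$; $\Omega=0$ in the rational case ($\rho=1$), where one puts $\omega_1=0$. The symbol $\pm$ inside a function denotes a product over both signs, e.g. $[x\pm y]=[x+y][x-y]$, $G(x\pm y+c)=G(x+y+c)G(x-y+c)$, $[x\pm y+c]=[x+y+c][x-y+c]$. $T_{x_i}^{\pm\delta}$ shifts $x_i\mapsto x_i\pm\delta$. Put $$c^{(\mu|\delta,\kappa)}=\sum_{s=1}^{2\rho}\mu_s-\tfrac{\rho}{2}(\delta+\kappa)+\sum_{s=1}^{\rho}\omega_s .$$ For $N$ variables $x=(x_1,\dots,x_N)$, the Ruijsenaars operator of type $BC_N$ (defined when $\kappa,\kappa-\delta\notin\Omega$) is $$E_x^{(\mu|\delta,\kappa)}=\sum_{i=1}^{N}A_i^{+}(x)T_{x_i}^{\delta}+\sum_{i=1}^{N}A_i^{-}(x)T_{x_i}^{-\delta}+\sum_{r=1}^{\rho}A_r^{0}(x),$$ with $$A_i^{+}(x)=\frac{\prod_{s=1}^{2\rho}[x_i+\mu_s]}{\prod_{s=1}^{\rho}[x_i-\frac12\omega_s][x_i+\frac12(\delta-\omega_s)]}\prod_{1\le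 j\le N,\,j\ne i}\frac{[x_i\pm x_j+\kappa]}{[x_i\pm x_j]},\qquad A_i^{-}(x)=A_i^{+}(-x),$$ $$A_r^{0}(x)=\frac{\prod_{s=1}^{2\rho}[\frac12(\omega_r-\delta)+\mu_s]}{[\kappa]\prod_{s\ne r}[\frac12(\omega_r-\omega_s)]\prod_{s=1}^{\rho}[\frac12(\omega_r-\omega_s+\kappa-\delta)]}\prod_{j=1}^{N}\frac{[\frac12(\omega_r-\delta)\pm x_j+\kappa]}{[\frac12(\omega_r-\delta)\pm x_j]} .$$ Operators with subscript $x$ use $N=m$, those with subscript $y$ use $N=n$ (for $N=0$ the operator is multiplication by the constant $\sum_rA_r^0$). $E_y^{(\mu|\kappa,\delta)}$ is obtained by exchanging $\delta$ and $\kappa$ in the definition (so the shifts are by $\pm\kappa$). *)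

theory Defs
  imports "HOL-Complex_Analysis.Complex_Analysis"
begin

text \<open>
  Throughout, \<open>br\<close> is the bracket $[u]$, and the points \<open>x\<close>, \<open>y\<close> and the parameter vectors
  \<open>\<omega>\<close>, \<open>\<mu>\<close>, \<open>\<nu>\<close> are functions on \<open>nat\<close> of which only the entries with indices
  $1,\dots,N$, respectively $1,\dots,\rho$ or $1,\dots,2\rho$, matter.
\<close>

text \<open>The trigonometric (\<open>\<rho> = 2\<close>) or rational (\<open>\<rho> = 1\<close>) case.\<close>

definition bracket_data :: "nat \<Rightarrow> (nat \<Rightarrow> complex) \<Rightarrow> (complex \<Rightarrow> complex) \<Rightarrow> bool" where
  "bracket_data \<rho> \<omega> br \<longleftrightarrow>
     (\<rho> = 2 \<and> \<omega> 1 \<noteq> 0 \<and> \<omega> 2 = 0 \<and>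
       (\<exists>a. a \<noteq> 0 \<and> (\<forall>u. br u = a * sin (of_real pi * u / \<omega> 1)))) \<or>
     (\<rho> = 1 \<and> \<omega> 1 = 0 \<and> (\<exists>a. a \<noteq> 0 \<and> (\<forall>u. br u = a * u)))"

definition zero_set :: "(complex \<Rightarrow> complex) \<Rightarrow> complex set" where
  "zero_set br = {u. br u = 0}"

text \<open>\<open>pm f a b c\<close> is $f(a\pm b+c)=f(a+b+c)\,f(a-b+c)$.\<close>

definition pm :: "(complex \<Rightarrow> complex) \<Rightarrow> complex \<Rightarrow> complex \<Rightarrow> complex \<Rightarrow> complex" where
  "pm f a b c = f (a + b + c) * f (a - b + c)"

definition c_const :: "nat \<Rightarrow> (nat \<Rightarrow> complex) \<Rightarrow> (nat \<Rightarrow> complex) \<Rightarrow> complex \<Rightarrow> complex \<Rightarrow> complex" where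
  "c_const \<rho> \<omega> \<mu> \<delta> \<kappa> =
     (\<Sum>s=1..2*\<rho>. \<mu> s) - of_nat \<rho> / 2 * (\<delta> + \<kappa>) + (\<Sum>s=1..\<rho>. \<omega> s)"

definition A_plus :: "nat \<Rightarrow> (nat \<Rightarrow> complex) \<Rightarrow> (complex \<Rightarrow> complex) \<Rightarrow> (nat \<Rightarrow> complex) \<Rightarrow>
    complex \<Rightarrow> complex \<Rightarrow> nat \<Rightarrow> nat \<Rightarrow> (nat \<Rightarrow> complex) \<Rightarrow> complex" where
  "A_plus \<rho> \<omega> br \<mu> \<delta> \<kappa> N i x =
     (\<Prod>s=1..2*\<rho>. br (x i + \<mu> s)) /
     (\<Prod>s=1..\<rho>. br (x i - \<omega> s / 2) * br (x i + (\<delta> - \<omega> s) / 2)) *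
     (\<Prod>j\<in>{1..N} - {i}. pm br (x i) (x j) \<kappa> / pm br (x i) (x j) 0)"

definition A_minus :: "nat \<Rightarrow> (nat \<Rightarrow> complex) \<Rightarrow> (complex \<Rightarrow> complex) \<Rightarrow> (nat \<Rightarrow> complex) \<Rightarrow>
    complex \<Rightarrow> complex \<Rightarrow> nat \<Rightarrow> nat \<Rightarrow> (nat \<Rightarrow> complex) \<Rightarrow> complex" where
  "A_minus \<rho> \<omega> br \<mu> \<delta> \<kappa> N i x = A_plus \<rho> \<omega> br \<mu> \<delta> \<kappa> N i (\<lambda>j. - x j)"

definition A_zero :: "nat \<Rightarrow> (nat \<Rightarrow> complex) \<Rightarrow> (complex \<Rightarrow> complex) \<Rightarrow> (nat \<Rightarrow> complex) \<Rightarrow>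
    complex \<Rightarrow> complex \<Rightarrow> nat \<Rightarrow> nat \<Rightarrow> (nat \<Rightarrow> complex) \<Rightarrow> complex" where
  "A_zero \<rho> \<omega> br \<mu> \<delta> \<kappa> N r x =
     (\<Prod>s=1..2*\<rho>. br ((\<omega> r - \<delta>) / 2 + \<mu> s)) /
     (br \<kappa> * (\<Prod>s\<in>{1..\<rho>} - {r}. br ((\<omega> r - \<omega> s) / 2)) *
       (\<Prod>s=1..\<rho>. br ((\<omega> r - \<omega> s + \<kappa> - \<delta>) / 2))) *
     (\<Prod>j=1..N. pm br ((\<omega> r - \<delta>) / 2) (x j) \<kappa> / pm br ((\<omega> r - \<delta>) / 2) (x j) 0)"

text \<open>The Ruijsenaars operator of type $BC_N$, applied to \<open>f\<close>.\<close>

definition ruijsenaars_BC :: "nat \<Rightarrow> (nat \<Rightarrow> complex) \<Rightarrow> (complex \<Rightarrow> complex) \<Rightarrow> (nat \<Rightarrow> complex) \<Rightarrow>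
    complex \<Rightarrow> complex \<Rightarrow> nat \<Rightarrow> ((nat \<Rightarrow> complex) \<Rightarrow> complex) \<Rightarrow> (nat \<Rightarrow> complex) \<Rightarrow> complex" where
  "ruijsenaars_BC \<rho> \<omega> br \<mu> \<delta> \<kappa> N f x =
     (\<Sum>i=1..N. A_plus \<rho> \<omega> br \<mu> \<delta> \<kappa> N i x * f (x(i := x i + \<delta>))) +
     (\<Sum>i=1..N. A_minus \<rho> \<omega> br \<mu> \<delta> \<kappa> N i x * f (x(i := x i - \<delta>))) +
     (\<Sum>r=1..\<rho>. A_zero \<rho> \<omega> br \<mu> \<delta> \<kappa> N r x) * f x"

definition Phi_BC_quot :: "(complex \<Rightarrow> complex) \<Rightarrow> complex \<Rightarrow> complex \<Rightarrow> nat \<Rightarrow> nat \<Rightarrow>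
    (nat \<Rightarrow> complex) \<Rightarrow> (nat \<Rightarrow> complex) \<Rightarrow> complex" where
  "Phi_BC_quot G \<delta> \<kappa> m n x y =
     (\<Prod>j=1..m. \<Prod>l=1..n. pm G (x j) (y l) ((\<delta> - \<kappa>) / 2) / pm G (x j) (y l) ((\<delta> + \<kappa>) / 2))"

definition Phi_BC_prod :: "(complex \<Rightarrow> complex) \<Rightarrow> complex \<Rightarrow> complex \<Rightarrow> nat \<Rightarrow> nat \<Rightarrow>
    (nat \<Rightarrow> complex) \<Rightarrow> (nat \<Rightarrow> complex) \<Rightarrow> complex" where
  "Phi_BC_prod G \<delta> \<kappa> m n x y =
     (\<Prod>j=1..m. \<Prod>l=1..n. \<Prod>\<epsilon>\<^sub>1\<in>{1, -1}. \<Prod>\<epsilon>\<^sub>2\<in>{1, -1}.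
        G (\<epsilon>\<^sub>1 * x j + \<epsilon>\<^sub>2 * y l + (\<delta> - \<kappa>) / 2))"

definition Psi_BC :: "(complex \<Rightarrow> complex) \<Rightarrow> nat \<Rightarrow> nat \<Rightarrow>
    (nat \<Rightarrow> complex) \<Rightarrow> (nat \<Rightarrow> complex) \<Rightarrow> complex" where
  "Psi_BC br m n x y = (\<Prod>j=1..m. \<Prod>l=1..n. pm br (x j) (y l) 0)"

text \<open>
  The kernel identities are identities between meromorphic functions of \<open>(x, y)\<close>. They are read
  as equalities at every point at which each factor occurring in them is holomorphic (in
  particular, no denominator vanishes, so the convention \<open>u / 0 = 0\<close> plays no role). The points
  excluded by the following predicates lie on countably many hyperplanes.
\<close>

text \<open>The \<open>x\<close>-dependent denominators of $A_i^+(x)$, of $A_i^-(x)=A_i^+(-x)$ and of $A_r^0(x)$ do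
  not vanish. (The constant denominators of $A_r^0$ are nonzero for \<open>\<kappa>, \<kappa> - \<delta> \<notin> zero_set br\<close>.)\<close>

definition A_plus_regular :: "nat \<Rightarrow> (nat \<Rightarrow> complex) \<Rightarrow> (complex \<Rightarrow> complex) \<Rightarrow>
    complex \<Rightarrow> nat \<Rightarrow> nat \<Rightarrow> (nat \<Rightarrow> complex) \<Rightarrow> bool" where
  "A_plus_regular \<rho> \<omega> br \<delta> N i x \<longleftrightarrow>
     (\<forall>s\<in>{1..\<rho>}. br (x i - \<omega> s / 2) \<noteq> 0 \<and> br (x i + (\<delta> - \<omega> s) / 2) \<noteq> 0) \<and>
     (\<forall>j\<in>{1..N} - {i}. pm br (x i) (x j) 0 \<noteq> 0)"

definition BC_regular :: "nat \<Rightarrow> (nat \<Rightarrow> complex) \<Rightarrow> (complex \<Rightarrow> complex) \<Rightarrow>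
    complex \<Rightarrow> nat \<Rightarrow> (nat \<Rightarrow> complex) \<Rightarrow> bool" where
  "BC_regular \<rho> \<omega> br \<delta> N x \<longleftrightarrow>
     (\<forall>i\<in>{1..N}. A_plus_regular \<rho> \<omega> br \<delta> N i x \<and> A_plus_regular \<rho> \<omega> br \<delta> N i (\<lambda>j. - x j)) \<and>
     (\<forall>r\<in>{1..\<rho>}. \<forall>j\<in>{1..N}. pm br ((\<omega> r - \<delta>) / 2) (x j) 0 \<noteq> 0)"

definition Phi_BC_quot_regular :: "(complex \<Rightarrow> complex) \<Rightarrow> complex \<Rightarrow> complex \<Rightarrow> nat \<Rightarrow> nat \<Rightarrow>
    (nat \<Rightarrow> complex) \<Rightarrow> (nat \<Rightarrow> complex) \<Rightarrow> bool" where
  "Phi_BC_quot_regular G \<delta> \<kappa> m n x y \<longleftrightarrow>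
     (\<forall>j\<in>{1..m}. \<forall>l\<in>{1..n}. \<forall>\<epsilon>\<in>{1, -1}.
        G analytic_on {x j + \<epsilon> * y l + (\<delta> - \<kappa>) / 2} \<and>
        G analytic_on {x j + \<epsilon> * y l + (\<delta> + \<kappa>) / 2} \<and>
        G (x j + \<epsilon> * y l + (\<delta> + \<kappa>) / 2) \<noteq> 0)"

definition Phi_BC_prod_regular :: "(complex \<Rightarrow> complex) \<Rightarrow> complex \<Rightarrow> complex \<Rightarrow> nat \<Rightarrow> nat \<Rightarrow>
    (nat \<Rightarrow> complex) \<Rightarrow> (nat \<Rightarrow> complex) \<Rightarrow> bool" where
  "Phi_BC_prod_regular G \<delta> \<kappa> m n x y \<longleftrightarrow>
     (\<forall>j\<in>{1..m}. \<forall>l\<in>{1..n}. \<forall>\<epsilon>\<^sub>1\<in>{1, -1}. \<forall>\<epsilon>\<^sub>2\<in>{1, -1}.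
        G analytic_on {\<epsilon>\<^sub>1 * x j + \<epsilon>\<^sub>2 * y l + (\<delta> - \<kappa>) / 2})"

text \<open>\<open>R\<close> holds at \<open>(x, y)\<close> and at all its neighbours under the shifts by \<open>\<plusminus>\<delta>\<close> in one coordinate.\<close>

definition on_shifts :: "complex \<Rightarrow> nat \<Rightarrow> nat \<Rightarrow> ((nat \<Rightarrow> complex) \<Rightarrow> (nat \<Rightarrow> complex) \<Rightarrow> bool) \<Rightarrow>
    (nat \<Rightarrow> complex) \<Rightarrow> (nat \<Rightarrow> complex) \<Rightarrow> bool" where
  "on_shifts \<delta> m n R x y \<longleftrightarrow>
     R x y \<and>
     (\<forall>i\<in>{1..m}. R (x(i := x i + \<delta>)) y \<and> R (x(i := x i - \<delta>)) y) \<and>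
     (\<forall>l\<in>{1..n}. R x (y(l := y l + \<delta>)) \<and> R x (y(l := y l - \<delta>)))"

end

theory Submission
  imports Defs
begin

text \<open>
  Both identities are one partial fraction identity. The brackets $\sin$ and $u$ share the
  three-term relation, and this alone implies
  \[ \sum_k \frac{\prod_j [b_k-a_j]}{\prod_{j\ne k}[b_k-b_j]} = \Big[\sum_j (b_j-a_j)\Big] \]
  for equally many points $a_j$ and $b_j$ (\<open>partial_fraction\<close>), which is the residue theorem for the
  function $\prod_j [z-a_j]/[z-b_j]$ written without residues.

  Divide a kernel identity by its kernel function. For a parameter \<open>\<epsilon>\<close> consider
  \[ \frac{\prod_s [z-\frac12\delta+\mu_s]}{\prod_r [z-\frac12\omega_r][z-\frac12(\omega_r+\delta-\kappa)]}
     \prod_i \frac{[z\pm x_i-\frac12\delta+\kappa]}{[z\pm x_i-\frac12\delta]}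
     \prod_l \frac{[z\pm y_l+\frac12\epsilon]}{[z\pm y_l-\frac12\epsilon]} . \]
  Up to one common constant, its residues at $\pm x_i+\frac12\delta$ and at $\frac12\omega_r$ are the
  coefficients of $[\kappa]E_x^{(\mu|\delta,\kappa)}$, those of the shifts being multiplied by the quotients of the shifted
  kernel by the kernel. Its residues at $\pm y_l+\frac12\epsilon$ and at
  $\frac12(\omega_r+\delta-\kappa)$ are in the same way those of $[\epsilon]E_y^{(\mu'|\delta',\epsilon)}$ with
  $\delta'=\epsilon+\kappa-\delta$ and $\mu'_s=\mu_s+\frac12(\epsilon-\delta)$, and the sum of the
  residues is the bracket on the right-hand side (\<open>source_identity\<close>).

  The choice $\epsilon=\delta$ gives the identity for \<open>Psi_BC\<close>. The choice $\epsilon=-\kappa$ gives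
  the operator $E_y^{(-\nu|-\delta,-\kappa)}$, and this is $E_y^{(\nu|\delta,\kappa)}$
  (\<open>ruijsenaars_BC_reflect\<close>); hence the identity for both functions \<open>\<Phi>\<close>, which differ only in how the
  difference equation of \<open>G\<close> produces the shift quotients.

  The points listed above may collide, and a shift quotient may have a vanishing denominator, at points
  where the operators and the kernel are regular. Both sides are continuous along the line
  $(x_i+t,\,y_l+2t)$, and the exceptional values of \<open>t\<close> are isolated, so the identity holds at
  such points as a limit \<open>t \<rightarrow> 0\<close> (\<open>kernel_identity\<close>).
\<close>

section \<open>The bracket\<close>

text \<open>
  These are the common features of the trigonometric and the rational bracket from which everything
  below follows. A period \<open>\<omega> r\<close> may change the sign of the bracket. The constant in the duplication
  formula depends on \<open>\<rho>\<close> and on the normalization; it cancels in the end.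
\<close>

locale bracket =
  fixes \<rho> :: nat and \<omega> :: "nat \<Rightarrow> complex" and br :: "complex \<Rightarrow> complex"
  assumes three_term: "br (c - a) * br (p - q) = br (c - p) * br (a - q) + br (c - q) * br (p - a)"
    and nontrivial: "\<exists>u. br u \<noteq> 0"
    and period: "r \<in> {1..\<rho>} \<Longrightarrow> \<exists>\<tau>. \<tau> * \<tau> = 1 \<and> (\<forall>u. br (u + \<omega> r) = \<tau> * br u)"
    and duplication: "\<exists>C. C \<noteq> 0 \<and> (\<forall>u. br (2 * u) = C * (\<Prod>s=1..\<rho>. br (u - \<omega> s / 2)))"
    and half_periods_distinct:
      "r \<in> {1..\<rho>} \<Longrightarrow> s \<in> {1..\<rho>} \<Longrightarrow> r \<noteq> s \<Longrightarrow> br ((\<omega> r - \<omega> s) / 2) \<noteq> 0"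
    and holomorphic: "br holomorphic_on UNIV"

lemma bracket_data_imp_bracket:
  assumes "bracket_data \<rho> \<omega> br"
  shows "bracket \<rho> \<omega> br"
  using assms unfolding bracket_data_def
proof (elim disjE conjE exE)
  fix a
  assume \<rho>: "\<rho> = 2" and \<omega>: "\<omega> 1 \<noteq> 0" "\<omega> 2 = 0" and a: "a \<noteq> 0"
    and br: "\<forall>u. br u = a * sin (of_real pi * u / \<omega> 1)"
  have ix: "{1..\<rho>} = {1, 2}" using \<rho> by auto
  have half: "br (u - \<omega> 1 / 2) = - a * cos (of_real pi * u / \<omega> 1)" for u
  proof -
    have *: "of_real pi * (u - \<omega> 1 / 2) / \<omega> 1 = of_real pi * u / \<omega> 1 - of_real pi / 2"
      using \<omega> by (simp add: field_simps)
    show ?thesis unfolding br[rule_format] * by (simp add: sin_diff cos_of_real_pi_half sin_of_real_pi_half)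
  qed
  show ?thesis
  proof
    fix c a' p q
    \<comment> \<open>Pluecker relation of the vectors \<open>(sin, cos)\<close>; the addition formula suffices.\<close>
    show "br (c - a') * br (p - q) = br (c - p) * br (a' - q) + br (c - q) * br (p - a')"
      by (simp add: br diff_divide_distrib right_diff_distrib sin_diff) (simp add: algebra_simps)
  next
    have "br (\<omega> 1 / 2) \<noteq> 0" using a \<omega> br by (simp add: sin_of_real_pi_half)
    then show "\<exists>u. br u \<noteq> 0" by blast
  next
    fix r assume "r \<in> {1..\<rho>}"
    then consider "r = 1" | "r = 2" using ix by blast
    then show "\<exists>\<tau>. \<tau> * \<tau> = 1 \<and> (\<forall>u. br (u + \<omega> r) = \<tau> * br u)"
    proof cases
      case 1
      have "br (u + \<omega> r) = - 1 * br u" for u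
        using \<omega> 1 by (simp add: br distrib_left add_divide_distrib sin_add sin_of_real cos_of_real)
      then show ?thesis by (intro exI[of _ "-1"]) auto
    next
      case 2
      then show ?thesis using \<omega> by (intro exI[of _ "1"]) auto
    qed
  next
    have "br (2 * u) = (- 2 / a) * (\<Prod>s=1..\<rho>. br (u - \<omega> s / 2))" for u
    proof -
      have "(\<Prod>s=1..\<rho>. br (u - \<omega> s / 2)) = - a * cos (of_real pi * u / \<omega> 1) * br u"
        unfolding ix using half[of u] \<omega> by simp
      moreover have "br (2 * u) = a * (2 * sin (of_real pi * u / \<omega> 1) * cos (of_real pi * u / \<omega> 1))"
        unfolding sin_double[symmetric] by (simp add: br mult_ac)
      ultimately show ?thesis using a br by simp
    qed
    then show "\<exists>C. C \<noteq> 0 \<and> (\<forall>u. br (2 * u) = C * (\<Prod>s=1..\<rho>. br (u - \<omega> s / 2)))"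
      using a by (intro exI[of _ "- 2 / a"]) auto
  next
    fix r s assume "r \<in> {1..\<rho>}" "s \<in> {1..\<rho>}" "r \<noteq> s"
    then have "r = 1 \<and> s = 2 \<or> r = 2 \<and> s = 1" unfolding ix by blast
    then have "(\<omega> r - \<omega> s) / 2 = \<omega> 1 / 2 \<or> (\<omega> r - \<omega> s) / 2 = - \<omega> 1 / 2" using \<omega> by auto
    moreover have "br (\<omega> 1 / 2) \<noteq> 0" "br (- \<omega> 1 / 2) \<noteq> 0"
      using a \<omega> br by (simp_all add: sin_of_real_pi_half)
    ultimately show "br ((\<omega> r - \<omega> s) / 2) \<noteq> 0" by metis
  next
    have "br = (\<lambda>u. a * sin (of_real pi * u / \<omega> 1))" using br by auto
    then show "br holomorphic_on UNIV" using \<omega> by (auto intro!: holomorphic_intros)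
  qed
next
  fix a
  assume \<rho>: "\<rho> = 1" and \<omega>: "\<omega> 1 = 0" and a: "a \<noteq> 0" and br: "\<forall>u. br u = a * u"
  show ?thesis
  proof
    fix c a' p q
    show "br (c - a') * br (p - q) = br (c - p) * br (a' - q) + br (c - q) * br (p - a')"
      by (simp add: br algebra_simps)
  next
    show "\<exists>u. br u \<noteq> 0" using a br by (intro exI[of _ 1]) simp
  next
    fix r assume "r \<in> {1..\<rho>}"
    then show "\<exists>\<tau>. \<tau> * \<tau> = 1 \<and> (\<forall>u. br (u + \<omega> r) = \<tau> * br u)"
      using \<rho> \<omega> by (intro exI[of _ "1"]) auto
  next
    show "\<exists>C. C \<noteq> 0 \<and> (\<forall>u. br (2 * u) = C * (\<Prod>s=1..\<rho>. br (u - \<omega> s / 2)))"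
      using \<rho> \<omega> by (intro exI[of _ 2]) (simp add: br)
  next
    fix r s assume "r \<in> {1..\<rho>}" "s \<in> {1..\<rho>}" "r \<noteq> s"
    then show "br ((\<omega> r - \<omega> s) / 2) \<noteq> 0" using \<rho> by auto
  next
    have "br = (\<lambda>u. a * u)" using br by auto
    then show "br holomorphic_on UNIV" by (auto intro!: holomorphic_intros)
  qed
qed

context bracket
begin

lemma br_0 [simp]: "br 0 = 0"
  using three_term[of 0 0 0 0] by simp

lemma br_minus: "br (- u) = - br u"
proof -
  obtain v where "br v \<noteq> 0" using nontrivial by blast
  moreover have "br v * (br u + br (- u)) = 0"
    using three_term[of v u 0 0] by (simp add: algebra_simps)
  ultimately show ?thesis by (simp add: eq_neg_iff_add_eq_0 add.commute)
qed

lemma br_minus_eq_0_iff: "br (u - v) = 0 \<longleftrightarrow> br (v - u) = 0"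
  using br_minus[of "u - v"] by simp

section \<open>The partial fraction identity\<close>

text \<open>
  As functions of one $a_\alpha$, both sides satisfy the interpolation formula that the three-term
  relation expresses, so it is enough to compare them at $a_\alpha=b_p$ and $a_\alpha=b_q$ for two
  different poles. There the zero cancels the pole, and the identity with one pair of points fewer remains.
\<close>

lemma partial_fraction:
  assumes "finite A" "finite B" "card A = card B"
    and "\<And>k l. k \<in> B \<Longrightarrow> l \<in> B \<Longrightarrow> k \<noteq> l \<Longrightarrow> br (b k - b l) \<noteq> 0"
  shows "(\<Sum>k\<in>B. (\<Prod>j\<in>A. br (b k - a j)) / (\<Prod>j\<in>B - {k}. br (b k - b j)))
       = br ((\<Sum>k\<in>B. b k) - (\<Sum>j\<in>A. a j))"
  using assms
proof (induction "card B" arbitrary: A B)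
  case 0
  then have "A = {}" "B = {}" by auto
  then show ?case by simp
next
  case (Suc N)
  note distinct = Suc.prems(4)
  from Suc obtain \<alpha> where \<alpha>: "\<alpha> \<in> A" by (metis card.empty ex_in_conv nat.distinct(1))
  define A' where "A' = A - {\<alpha>}"
  have A: "A = insert \<alpha> A'" "\<alpha> \<notin> A'" "finite A'" using \<alpha> Suc.prems by (auto simp: A'_def)
  from Suc obtain p where p: "p \<in> B" by (metis card.empty ex_in_conv nat.distinct(1))
  show ?case
  proof (cases "B = {p}")
    case True
    then have "A' = {}" using Suc.prems A by auto
    then show ?thesis using True A by simp
  next
    case False
    then obtain q where q: "q \<in> B" "q \<noteq> p" using p by blast
    define c where "c k = (\<Prod>j\<in>A'. br (b k - a j)) / (\<Prod>j\<in>B - {k}. br (b k - b j))" for k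
    define S where "S = (\<Sum>k\<in>B. b k) - (\<Sum>j\<in>A'. a j)"
    \<comment> \<open>The sum for \<open>a \<alpha> = b r\<close>, to which the induction hypothesis for \<open>A'\<close> and \<open>B - {r}\<close> applies.\<close>
    have remove: "(\<Sum>k\<in>B. br (b k - b r) * c k) = br (S - b r)" if r: "r \<in> B" for r
    proof -
      have "(\<Sum>k\<in>B. br (b k - b r) * c k) = (\<Sum>k\<in>B - {r}. br (b k - b r) * c k)"
        using r Suc.prems by (subst sum.remove[of _ r]) auto
      also have "\<dots> = (\<Sum>k\<in>B - {r}. (\<Prod>j\<in>A'. br (b k - a j)) / (\<Prod>j\<in>B - {r} - {k}. br (b k - b j)))"
      proof (rule sum.cong[OF refl])
        fix k assume k: "k \<in> B - {r}"
        have "B - {k} - {r} = B - {r} - {k}" by auto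
        then have "(\<Prod>j\<in>B - {k}. br (b k - b j)) = br (b k - b r) * (\<Prod>j\<in>B - {r} - {k}. br (b k - b j))"
          using r k Suc.prems by (subst prod.remove[of _ r]) auto
        moreover have "br (b k - b r) \<noteq> 0" using distinct r k by auto
        ultimately show "br (b k - b r) * c k
            = (\<Prod>j\<in>A'. br (b k - a j)) / (\<Prod>j\<in>B - {r} - {k}. br (b k - b j))"
          by (simp add: c_def)
      qed
      also have "\<dots> = br ((\<Sum>k\<in>B - {r}. b k) - (\<Sum>j\<in>A'. a j))"
        using Suc.hyps(2) Suc.prems A r by (intro Suc.hyps(1)) auto
      also have "(\<Sum>k\<in>B - {r}. b k) - (\<Sum>j\<in>A'. a j) = S - b r"
        using r Suc.prems by (simp add: S_def sum.remove[of B r])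
      finally show ?thesis .
    qed
    have "br (b p - b q) * (\<Sum>k\<in>B. br (b k - a \<alpha>) * c k)
        = (\<Sum>k\<in>B. br (b k - b p) * c k) * br (a \<alpha> - b q)
        + (\<Sum>k\<in>B. br (b k - b q) * c k) * br (b p - a \<alpha>)"
      unfolding sum_distrib_left sum_distrib_right sum.distrib[symmetric]
    proof (rule sum.cong[OF refl])
      fix k
      have "br (b p - b q) * (br (b k - a \<alpha>) * c k) = (br (b k - a \<alpha>) * br (b p - b q)) * c k"
        by (simp add: mult_ac)
      then show "br (b p - b q) * (br (b k - a \<alpha>) * c k)
        = br (b k - b p) * c k * br (a \<alpha> - b q) + br (b k - b q) * c k * br (b p - a \<alpha>)"
        unfolding three_term[of "b k" "a \<alpha>" "b p" "b q"] by (simp add: algebra_simps)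
    qed
    also have "\<dots> = br (b p - b q) * br (S - a \<alpha>)"
      unfolding remove[OF p] remove[OF q(1)]
      using three_term[of S "a \<alpha>" "b p" "b q"] by (simp add: mult.commute)
    finally have "(\<Sum>k\<in>B. br (b k - a \<alpha>) * c k) = br (S - a \<alpha>)"
      using distinct p q by simp
    then show ?thesis using A by (simp add: c_def S_def algebra_simps)
  qed
qed

text \<open>
  In the applications most zeros are shifts $c_k-h_k$ of poles $c_k$. Pairing them makes the
  residue at $c_k$ the bracket $[h_k]$ times the remaining quotients, and only the shifts enter the total.
\<close>

lemma coupled_partial_fraction:
  assumes fin: "finite A" "finite B" "finite K" and card: "card A = card B"
    and bb: "\<And>k l. k \<in> B \<Longrightarrow> l \<in> B \<Longrightarrow> k \<noteq> l \<Longrightarrow> br (b k - b l) \<noteq> 0"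
    and cc: "\<And>k l. k \<in> K \<Longrightarrow> l \<in> K \<Longrightarrow> k \<noteq> l \<Longrightarrow> br (c k - c l) \<noteq> 0"
    and cb: "\<And>k l. k \<in> K \<Longrightarrow> l \<in> B \<Longrightarrow> br (c k - b l) \<noteq> 0"
  shows "(\<Sum>k\<in>B. (\<Prod>j\<in>A. br (b k - a j)) / (\<Prod>j\<in>B - {k}. br (b k - b j))
              * (\<Prod>j\<in>K. br (b k - c j + h j) / br (b k - c j)))
       + (\<Sum>k\<in>K. br (h k) * ((\<Prod>j\<in>A. br (c k - a j)) / (\<Prod>j\<in>B. br (c k - b j)))
              * (\<Prod>j\<in>K - {k}. br (c k - c j + h j) / br (c k - c j)))
       = br ((\<Sum>k\<in>B. b k) - (\<Sum>j\<in>A. a j) + (\<Sum>k\<in>K. h k))"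
proof -
  define bc where "bc = case_sum b c"
  define ac where "ac = case_sum a (\<lambda>k. c k - h k)"
  have diff_Inl: "B <+> K - {Inl k} = (B - {k}) <+> K" for k by auto
  have diff_Inr: "B <+> K - {Inr k} = B <+> (K - {k})" for k by auto
  have "(\<Sum>k\<in>B <+> K. (\<Prod>j\<in>A <+> K. br (bc k - ac j)) / (\<Prod>j\<in>B <+> K - {k}. br (bc k - bc j)))
     = br ((\<Sum>k\<in>B <+> K. bc k) - (\<Sum>j\<in>A <+> K. ac j))"
  proof (rule partial_fraction)
    show "card (A <+> K) = card (B <+> K)" using fin card by (simp add: card_Plus)
    fix k l assume "k \<in> B <+> K" "l \<in> B <+> K" "k \<noteq> l"
    then show "br (bc k - bc l) \<noteq> 0"
      by (elim PlusE) (simp_all add: bc_def bb cc cb br_minus_eq_0_iff[of "b _" "c _"])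
  qed (use fin in auto)
  moreover have "(\<Sum>k\<in>B <+> K. bc k) - (\<Sum>j\<in>A <+> K. ac j)
      = (\<Sum>k\<in>B. b k) - (\<Sum>j\<in>A. a j) + (\<Sum>k\<in>K. h k)"
    using fin by (simp add: sum.Plus bc_def ac_def sum_subtractf)
  moreover have "(\<Sum>k\<in>B <+> K. (\<Prod>j\<in>A <+> K. br (bc k - ac j)) / (\<Prod>j\<in>B <+> K - {k}. br (bc k - bc j)))
    = (\<Sum>k\<in>B. (\<Prod>j\<in>A. br (b k - a j)) / (\<Prod>j\<in>B - {k}. br (b k - b j))
              * (\<Prod>j\<in>K. br (b k - c j + h j) / br (b k - c j)))
       + (\<Sum>k\<in>K. br (h k) * ((\<Prod>j\<in>A. br (c k - a j)) / (\<Prod>j\<in>B. br (c k - b j)))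
              * (\<Prod>j\<in>K - {k}. br (c k - c j + h j) / br (c k - c j)))"
  proof -
    have "(\<Prod>j\<in>K. br (c k - c j + h j)) = br (h k) * (\<Prod>j\<in>K - {k}. br (c k - c j + h j))"
      if "k \<in> K" for k
      using that fin by (simp add: prod.remove[of K k])
    then show ?thesis
      using fin unfolding bc_def ac_def
      by (simp add: sum.Plus prod.Plus diff_Inl diff_Inr prod_dividef algebra_simps cong: sum.cong)
  qed
  ultimately show ?thesis by simp
qed

section \<open>Half periods and the duplication formula\<close>

definition dup_const :: complex where
  "dup_const = (SOME C. C \<noteq> 0 \<and> (\<forall>u. br (2 * u) = C * (\<Prod>s=1..\<rho>. br (u - \<omega> s / 2))))"

lemma dup_nonzero: "dup_const \<noteq> 0"
  and prod_half_periods: "(\<Prod>s=1..\<rho>. br (u - \<omega> s / 2)) = br (2 * u) / dup_const"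
proof -
  have *: "dup_const \<noteq> 0 \<and> (\<forall>u. br (2 * u) = dup_const * (\<Prod>s=1..\<rho>. br (u - \<omega> s / 2)))"
    unfolding dup_const_def by (rule someI_ex[OF duplication])
  then show "dup_const \<noteq> 0" by blast
  then show "(\<Prod>s=1..\<rho>. br (u - \<omega> s / 2)) = br (2 * u) / dup_const" using * by simp
qed

lemma br_add_period_eq_0_iff:
  assumes "r \<in> {1..\<rho>}"
  shows "br (u + \<omega> r) = 0 \<longleftrightarrow> br u = 0"
  using period[OF assms] by fastforce

text \<open>
  Excluding the zeros of $[2u]$ excludes all half periods at once. This is how the regularity
  conditions of the operators, which run over the half periods, are used throughout.
\<close>

lemma br_half_period_nonzero:
  assumes "r \<in> {1..\<rho>}" "br (2 * u) \<noteq> 0"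
  shows "br (u - \<omega> r / 2) \<noteq> 0" "br (\<omega> r / 2 + u) \<noteq> 0"
proof -
  have "(\<Prod>s=1..\<rho>. br (u - \<omega> s / 2)) \<noteq> 0"
    unfolding prod_half_periods using assms dup_nonzero by simp
  then show *: "br (u - \<omega> r / 2) \<noteq> 0" using assms by auto
  show "br (\<omega> r / 2 + u) \<noteq> 0"
    using br_add_period_eq_0_iff[OF assms(1), of "u - \<omega> r / 2"] * by (simp add: algebra_simps)
qed

text \<open>
  Up to a sign the bracket is even about each half period, and the sign cancels in the product of two factors.
\<close>

lemma pm_half_period_even:
  assumes "r \<in> {1..\<rho>}"
  shows "pm br (\<omega> r / 2 + v) w c = pm br (\<omega> r / 2 - v) w (- c)"
proof -
  obtain \<tau> where \<tau>: "\<tau> * \<tau> = 1" "\<And>u. br (u + \<omega> r) = \<tau> * br u" using period[OF assms] by blast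
  have flip: "br (\<omega> r / 2 + u) = - \<tau> * br (\<omega> r / 2 - u)" for u
    using \<tau>(2)[of "u - \<omega> r / 2"] br_minus[of "\<omega> r / 2 - u"] by (simp add: algebra_simps)
  have "br (\<omega> r / 2 + v + w + c) = - \<tau> * br (\<omega> r / 2 - v - w - c)"
    using flip[of "v + w + c"] by (simp add: algebra_simps)
  moreover have "br (\<omega> r / 2 + v - w + c) = - \<tau> * br (\<omega> r / 2 - v + w - c)"
    using flip[of "v - w + c"] by (simp add: algebra_simps)
  ultimately have "pm br (\<omega> r / 2 + v) w c = (\<tau> * \<tau>) * pm br (\<omega> r / 2 - v) w (- c)"
    by (simp add: pm_def)
  then show ?thesis by (simp add: \<tau>(1))
qed

text \<open>
  The case of poles placed symmetrically as $\pm w_i+e_i$ with shift $h_i$, together with the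
  half periods and their translates by $\frac12 d$. The points and centres are kept abstract, so that the
  variables \<open>x\<close> and \<open>y\<close> of the kernel become two families of the same kind. At $w_i+e_i$ the
  factor belonging to $-w_i+e_i$ contributes $[2w_i+h_i]/[2w_i]$.
\<close>

lemma symmetric_partial_fraction:
  fixes P :: "'p set" and w e h :: "'p \<Rightarrow> complex" and a :: "nat \<Rightarrow> complex" and d :: complex
  defines "U \<equiv> \<lambda>i z. dup_const ^ 2 * (\<Prod>s=1..2*\<rho>. br (z + e i - a s))
      / (br (2 * (z + e i)) * br (2 * (z + e i) - d)) * (br (2 * z + h i) / br (2 * z))
      * (\<Prod>j\<in>P - {i}. pm br (z + e i - e j) (w j) (h j) / pm br (z + e i - e j) (w j) 0)"
  assumes fin: "finite P" and d: "br d \<noteq> 0"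
    and w: "\<And>i. i \<in> P \<Longrightarrow> br (2 * w i) \<noteq> 0"
    and e: "\<And>i z. i \<in> P \<Longrightarrow> z \<in> {w i, - w i} \<Longrightarrow> br (2 * (z + e i)) \<noteq> 0 \<and> br (2 * (z + e i) - d) \<noteq> 0"
    and ww: "\<And>i j z. i \<in> P \<Longrightarrow> j \<in> P \<Longrightarrow> i \<noteq> j \<Longrightarrow> z \<in> {w i, - w i} \<Longrightarrow> pm br (z + e i - e j) (w j) 0 \<noteq> 0"
  shows "(\<Sum>r=1..\<rho>. (\<Prod>s=1..2*\<rho>. br (\<omega> r / 2 - a s))
            / ((\<Prod>s\<in>{1..\<rho>} - {r}. br ((\<omega> r - \<omega> s) / 2)) * (br (\<omega> r - d) / dup_const))
            * (\<Prod>i\<in>P. pm br (\<omega> r / 2 - e i) (w i) (h i) / pm br (\<omega> r / 2 - e i) (w i) 0))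
       + (\<Sum>r=1..\<rho>. (\<Prod>s=1..2*\<rho>. br ((\<omega> r + d) / 2 - a s))
            / ((\<Prod>s\<in>{1..\<rho>} - {r}. br ((\<omega> r - \<omega> s) / 2)) * (br (\<omega> r + d) / dup_const))
            * (\<Prod>i\<in>P. pm br ((\<omega> r + d) / 2 - e i) (w i) (h i) / pm br ((\<omega> r + d) / 2 - e i) (w i) 0))
       + (\<Sum>i\<in>P. br (h i) * (U i (w i) + U i (- w i)))
       = br ((\<Sum>r=1..\<rho>. \<omega> r) + of_nat \<rho> / 2 * d - (\<Sum>s=1..2*\<rho>. a s) + 2 * (\<Sum>i\<in>P. h i))"
proof -
  define B where "B = {1..\<rho>} <+> {1..\<rho>}"
  define K where "K = P <+> P"
  define b where "b = case_sum (\<lambda>r. \<omega> r / 2) (\<lambda>r. (\<omega> r + d) / 2)"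
  define c where "c = case_sum (\<lambda>i. w i + e i) (\<lambda>i. - w i + e i)"
  define h' where "h' = case_sum h h"
  have b_simps [simp]: "b (Inl r) = \<omega> r / 2" "b (Inr r) = (\<omega> r + d) / 2" for r by (simp_all add: b_def)
  have c_simps [simp]: "c (Inl i) = w i + e i" "c (Inr i) = - w i + e i" for i by (simp_all add: c_def)
  have h_simps [simp]: "h' (Inl i) = h i" "h' (Inr i) = h i" for i by (simp_all add: h'_def)
  have diff_Inl: "X <+> Y - {Inl k} = (X - {k}) <+> Y" for X :: "'x set" and Y :: "'y set" and k by auto
  have diff_Inr: "X <+> Y - {Inr k} = X <+> (Y - {k})" for X :: "'x set" and Y :: "'y set" and k by auto
  have finBK: "finite B" "finite K" using fin by (auto simp: B_def K_def)
  have \<omega>d: "br (\<omega> r - d) \<noteq> 0" "br (\<omega> r + d) \<noteq> 0" if "r \<in> {1..\<rho>}" for r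
    using that d br_add_period_eq_0_iff[of r d] br_add_period_eq_0_iff[of r "- d"] br_minus[of d]
    by (auto simp: add.commute)
  \<comment> \<open>The half periods and their translates are separated because \<open>d\<close> is not a period.\<close>
  have crossed: "br ((\<omega> r + d) / 2 - \<omega> s / 2) \<noteq> 0" if "r \<in> {1..\<rho>}" "s \<in> {1..\<rho>}" for r s
  proof -
    have "2 * ((\<omega> r + d) / 2) = \<omega> r + d" by simp
    then show ?thesis using br_half_period_nonzero(1)[of s "(\<omega> r + d) / 2"] \<omega>d that by metis
  qed
  have prod_B: "(\<Prod>k\<in>B. br (z - b k)) = br (2 * z) * br (2 * z - d) / dup_const ^ 2" for z
  proof -
    have "(\<Prod>k\<in>B. br (z - b k))
        = (\<Prod>r=1..\<rho>. br (z - \<omega> r / 2)) * (\<Prod>r=1..\<rho>. br ((z - d / 2) - \<omega> r / 2))"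
      by (simp add: B_def prod.Plus diff_divide_distrib add_divide_distrib algebra_simps)
    then show ?thesis unfolding prod_half_periods
      by (simp add: power2_eq_square right_diff_distrib)
  qed
  have prod_B_Inl: "(\<Prod>k\<in>B - {Inl r}. br (\<omega> r / 2 - b k))
      = (\<Prod>s\<in>{1..\<rho>} - {r}. br ((\<omega> r - \<omega> s) / 2)) * (br (\<omega> r - d) / dup_const)" for r
  proof -
    have "(\<Prod>s=1..\<rho>. br (\<omega> r / 2 - (\<omega> s + d) / 2)) = br (\<omega> r - d) / dup_const"
      using prod_half_periods[of "\<omega> r / 2 - d / 2"]
      by (simp add: diff_divide_distrib add_divide_distrib algebra_simps)
    then show ?thesis unfolding B_def diff_Inl
      by (simp add: prod.Plus diff_divide_distrib)
  qed
  have prod_B_Inr: "(\<Prod>k\<in>B - {Inr r}. br ((\<omega> r + d) / 2 - b k))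
      = (\<Prod>s\<in>{1..\<rho>} - {r}. br ((\<omega> r - \<omega> s) / 2)) * (br (\<omega> r + d) / dup_const)" for r
  proof -
    have "(\<Prod>s=1..\<rho>. br ((\<omega> r + d) / 2 - \<omega> s / 2)) = br (\<omega> r + d) / dup_const"
    proof -
      have "2 * ((\<omega> r + d) / 2) = \<omega> r + d" by simp
      then show ?thesis unfolding prod_half_periods by (simp only:)
    qed
    then show ?thesis unfolding B_def diff_Inr
      by (simp add: prod.Plus diff_divide_distrib add_divide_distrib)
  qed
  have pm_factor: "br (z - (w i + e i) + h i) / br (z - (w i + e i))
        * (br (z - (- w i + e i) + h i) / br (z - (- w i + e i)))
      = pm br (z - e i) (w i) (h i) / pm br (z - e i) (w i) 0" for z i
    by (simp add: pm_def algebra_simps)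
  have prod_K: "(\<Prod>k\<in>K. br (z - c k + h' k) / br (z - c k))
      = (\<Prod>i\<in>P. pm br (z - e i) (w i) (h i) / pm br (z - e i) (w i) 0)" for z
    unfolding K_def pm_factor[symmetric] prod.distrib using fin by (simp add: prod.Plus)
  have prod_K_Inl: "(\<Prod>k\<in>K - {Inl i}. br (z - c k + h' k) / br (z - c k))
      = br (z + w i - e i + h i) / br (z + w i - e i)
        * (\<Prod>j\<in>P - {i}. pm br (z - e j) (w j) (h j) / pm br (z - e j) (w j) 0)" if "i \<in> P" for z i
    unfolding K_def diff_Inl pm_factor[symmetric] prod.distrib using fin that
    by (simp add: prod.Plus prod.remove[of P i] algebra_simps)
  have prod_K_Inr: "(\<Prod>k\<in>K - {Inr i}. br (z - c k + h' k) / br (z - c k))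
      = br (z - w i - e i + h i) / br (z - w i - e i)
        * (\<Prod>j\<in>P - {i}. pm br (z - e j) (w j) (h j) / pm br (z - e j) (w j) 0)" if "i \<in> P" for z i
    unfolding K_def diff_Inr pm_factor[symmetric] prod.distrib using fin that
    by (simp add: prod.Plus prod.remove[of P i] algebra_simps)
  have "(\<Sum>k\<in>B. (\<Prod>j\<in>{1..2*\<rho>}. br (b k - a j)) / (\<Prod>j\<in>B - {k}. br (b k - b j))
              * (\<Prod>j\<in>K. br (b k - c j + h' j) / br (b k - c j)))
       + (\<Sum>k\<in>K. br (h' k) * ((\<Prod>j\<in>{1..2*\<rho>}. br (c k - a j)) / (\<Prod>j\<in>B. br (c k - b j)))
              * (\<Prod>j\<in>K - {k}. br (c k - c j + h' j) / br (c k - c j)))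
       = br ((\<Sum>k\<in>B. b k) - (\<Sum>j\<in>{1..2*\<rho>}. a j) + (\<Sum>k\<in>K. h' k))"
  proof (rule coupled_partial_fraction)
    show "card {1..2*\<rho>} = card B" by (simp add: B_def card_Plus)
  next
    fix k l assume "k \<in> B" "l \<in> B" "k \<noteq> l"
    then show "br (b k - b l) \<noteq> 0"
      unfolding B_def using crossed half_periods_distinct br_minus_eq_0_iff
      by (elim PlusE) (simp_all add: diff_divide_distrib add_divide_distrib)
  next
    fix k l assume "k \<in> K" "l \<in> K" "k \<noteq> l"
    then show "br (c k - c l) \<noteq> 0"
      unfolding K_def
    proof (elim PlusE)
      fix i j assume *: "k = Inl i" "i \<in> P" "l = Inl j" "j \<in> P"
      with \<open>k \<noteq> l\<close> ww[of i j "w i"] show ?thesis by (simp add: pm_def algebra_simps)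
    next
      fix i j assume *: "k = Inr i" "i \<in> P" "l = Inr j" "j \<in> P"
      with \<open>k \<noteq> l\<close> ww[of i j "- w i"] show ?thesis by (simp add: pm_def algebra_simps)
    next
      fix i j assume *: "k = Inl i" "i \<in> P" "l = Inr j" "j \<in> P"
      with w[of i] ww[of i j "w i"] show ?thesis
        by (cases "i = j") (simp_all add: pm_def algebra_simps)
    next
      fix i j assume *: "k = Inr i" "i \<in> P" "l = Inl j" "j \<in> P"
      with w[of i] br_minus[of "2 * w i"] ww[of i j "- w i"] show ?thesis
        by (cases "i = j") (simp_all add: pm_def algebra_simps)
    qed
  next
    fix k l assume kl: "k \<in> K" "l \<in> B"
    then obtain i where "i \<in> P" "c k = w i + e i \<or> c k = - w i + e i" by (auto simp: K_def)
    then obtain z where i: "i \<in> P" "z \<in> {w i, - w i}" "c k = z + e i" by blast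
    have "(\<Prod>j\<in>B. br (c k - b j)) \<noteq> 0" unfolding prod_B i(3) using e[OF i(1,2)] dup_nonzero by simp
    then show "br (c k - b l) \<noteq> 0" using kl finBK by auto
  qed (use finBK in auto)
  moreover have "(\<Sum>k\<in>B. b k) - (\<Sum>j\<in>{1..2*\<rho>}. a j) + (\<Sum>k\<in>K. h' k)
      = (\<Sum>r=1..\<rho>. \<omega> r) + of_nat \<rho> / 2 * d - (\<Sum>s=1..2*\<rho>. a s) + 2 * (\<Sum>i\<in>P. h i)"
    using fin by (simp add: B_def K_def sum.Plus sum.distrib add_divide_distrib sum_divide_distrib[symmetric])
  moreover have "(\<Sum>k\<in>B. (\<Prod>j\<in>{1..2*\<rho>}. br (b k - a j)) / (\<Prod>j\<in>B - {k}. br (b k - b j))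
              * (\<Prod>j\<in>K. br (b k - c j + h' j) / br (b k - c j)))
      = (\<Sum>r=1..\<rho>. (\<Prod>s=1..2*\<rho>. br (\<omega> r / 2 - a s))
            / ((\<Prod>s\<in>{1..\<rho>} - {r}. br ((\<omega> r - \<omega> s) / 2)) * (br (\<omega> r - d) / dup_const))
            * (\<Prod>i\<in>P. pm br (\<omega> r / 2 - e i) (w i) (h i) / pm br (\<omega> r / 2 - e i) (w i) 0))
       + (\<Sum>r=1..\<rho>. (\<Prod>s=1..2*\<rho>. br ((\<omega> r + d) / 2 - a s))
            / ((\<Prod>s\<in>{1..\<rho>} - {r}. br ((\<omega> r - \<omega> s) / 2)) * (br (\<omega> r + d) / dup_const))
            * (\<Prod>i\<in>P. pm br ((\<omega> r + d) / 2 - e i) (w i) (h i) / pm br ((\<omega> r + d) / 2 - e i) (w i) 0))"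
    unfolding prod_K prod_B_Inl[symmetric] prod_B_Inr[symmetric]
    by (subst (1) B_def, subst sum.Plus) simp_all
  moreover have "(\<Sum>k\<in>K. br (h' k) * ((\<Prod>j\<in>{1..2*\<rho>}. br (c k - a j)) / (\<Prod>j\<in>B. br (c k - b j)))
              * (\<Prod>j\<in>K - {k}. br (c k - c j + h' j) / br (c k - c j)))
      = (\<Sum>i\<in>P. br (h i) * (U i (w i) + U i (- w i)))"
  proof -
    define T where "T k = br (h' k) * ((\<Prod>j\<in>{1..2*\<rho>}. br (c k - a j)) / (\<Prod>j\<in>B. br (c k - b j)))
              * (\<Prod>j\<in>K - {k}. br (c k - c j + h' j) / br (c k - c j))" for k
    have "T (Inl i) = br (h i) * U i (w i)" if "i \<in> P" for i
    proof -
      have "w i + e i + w i - e i = 2 * w i" by simp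
      then show ?thesis unfolding T_def c_simps h_simps prod_K_Inl[OF that] prod_B U_def by simp
    qed
    moreover have "T (Inr i) = br (h i) * U i (- w i)" if "i \<in> P" for i
    proof -
      have "- w i + e i - w i - e i = 2 * - w i" by simp
      then show ?thesis unfolding T_def c_simps h_simps prod_K_Inr[OF that] prod_B U_def by (simp only:) simp
    qed
    ultimately have "(\<Sum>k\<in>K. T k) = (\<Sum>i\<in>P. br (h i) * (U i (w i) + U i (- w i)))"
      using fin by (simp add: K_def sum.Plus sum.distrib distrib_left)
    then show ?thesis by (simp only: T_def)
  qed
  ultimately show ?thesis by (simp only:)
qed

section \<open>The coefficients of the Ruijsenaars operator\<close>

text \<open>
  By duplication the products over the half periods collapse to single brackets, which makes parity
  and regularity of the coefficients visible for both values of \<open>\<rho>\<close> at once.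
\<close>

lemma A_plus_eq:
  "A_plus \<rho> \<omega> br \<mu> \<delta> \<kappa> N i x = dup_const ^ 2 * (\<Prod>s=1..2*\<rho>. br (x i + \<mu> s)) / (br (2 * x i) * br (2 * x i + \<delta>))
     * (\<Prod>j\<in>{1..N} - {i}. pm br (x i) (x j) \<kappa> / pm br (x i) (x j) 0)"
proof -
  have "(\<Prod>s=1..\<rho>. br (x i + (\<delta> - \<omega> s) / 2)) = (\<Prod>s=1..\<rho>. br (x i + \<delta> / 2 - \<omega> s / 2))"
    by (simp add: diff_divide_distrib algebra_simps)
  then show ?thesis
    unfolding A_plus_def prod.distrib prod_half_periods
    by (simp add: power2_eq_square distrib_left)
qed

lemma A_zero_eq:
  "A_zero \<rho> \<omega> br \<mu> \<delta> \<kappa> N r x = dup_const * (\<Prod>s=1..2*\<rho>. br ((\<omega> r - \<delta>) / 2 + \<mu> s))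
     / (br \<kappa> * (\<Prod>s\<in>{1..\<rho>} - {r}. br ((\<omega> r - \<omega> s) / 2)) * br (\<omega> r + \<kappa> - \<delta>))
     * (\<Prod>j=1..N. pm br ((\<omega> r - \<delta>) / 2) (x j) \<kappa> / pm br ((\<omega> r - \<delta>) / 2) (x j) 0)"
proof -
  have "(\<Prod>s=1..\<rho>. br ((\<omega> r - \<omega> s + \<kappa> - \<delta>) / 2)) = (\<Prod>s=1..\<rho>. br ((\<omega> r + \<kappa> - \<delta>) / 2 - \<omega> s / 2))"
    by (intro prod.cong refl arg_cong[of _ _ br]) (simp add: field_simps)
  moreover have "2 * ((\<omega> r + \<kappa> - \<delta>) / 2) = \<omega> r + \<kappa> - \<delta>" by simp
  ultimately show ?thesis
    unfolding A_zero_def prod_half_periods by (simp only:) simp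
qed

lemma pm_minus: "pm br (- a) b (- c) = pm br a b c"
proof -
  have "br (- a + b + - c) = - br (a - b + c)" "br (- a - b + - c) = - br (a + b + c)"
    by (simp_all add: br_minus[symmetric] algebra_simps)
  then show ?thesis by (simp add: pm_def mult.commute)
qed

lemma pm_minus_right: "pm f a (- b) c = pm f a b c"
  by (simp add: pm_def mult.commute)

lemma prod_br_minus: "(\<Prod>s=1..2*\<rho>. br (- f s)) = (\<Prod>s=1..2*\<rho>. br (f s))"
  by (simp add: br_minus prod.distrib[symmetric] prod_uminus)

lemma A_plus_reflect:
  assumes "\<And>s. s \<in> {1..2*\<rho>} \<Longrightarrow> \<mu>' s = - \<mu> s"
  shows "A_plus \<rho> \<omega> br \<mu>' (- \<delta>) (- \<kappa>) N i x = A_plus \<rho> \<omega> br \<mu> \<delta> \<kappa> N i (\<lambda>j. - x j)"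
proof -
  have "(\<Prod>s=1..2*\<rho>. br (x i + \<mu>' s)) = (\<Prod>s=1..2*\<rho>. br (- (- x i + \<mu> s)))"
    by (intro prod.cong refl arg_cong[of _ _ br]) (simp add: assms)
  moreover have "br (2 * x i) * br (2 * x i + - \<delta>) = br (2 * - x i) * br (2 * - x i + \<delta>)"
    using br_minus[of "2 * x i"] br_minus[of "2 * x i - \<delta>"] by (simp add: algebra_simps)
  moreover have "pm br (x i) (x j) (- \<kappa>) / pm br (x i) (x j) 0
      = pm br (- x i) (- x j) \<kappa> / pm br (- x i) (- x j) 0" for j
    using pm_minus[of "- x i" "x j" \<kappa>] pm_minus[of "- x i" "x j" 0] by (simp add: pm_minus_right)
  ultimately show ?thesis
    unfolding A_plus_eq prod_br_minus by (simp only:)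
qed

lemma A_zero_reflect:
  assumes \<mu>': "\<And>s. s \<in> {1..2*\<rho>} \<Longrightarrow> \<mu>' s = - \<mu> s" and r: "r \<in> {1..\<rho>}"
  shows "A_zero \<rho> \<omega> br \<mu>' (- \<delta>) (- \<kappa>) N r x = A_zero \<rho> \<omega> br \<mu> \<delta> \<kappa> N r x"
proof -
  obtain \<tau> where \<tau>: "\<tau> * \<tau> = 1" "\<And>u. br (u + \<omega> r) = \<tau> * br u" using period[OF r] by blast
  have flip: "br ((\<omega> r - - \<delta>) / 2 + \<mu>' s) = - \<tau> * br ((\<omega> r - \<delta>) / 2 + \<mu> s)" if "s \<in> {1..2*\<rho>}" for s
  proof -
    have "br ((\<omega> r - - \<delta>) / 2 + \<mu>' s) = br (- ((\<omega> r - \<delta>) / 2 + \<mu> s) + \<omega> r)"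
      using \<mu>'[OF that] by (intro arg_cong[of _ _ br]) (simp add: field_simps)
    then show ?thesis unfolding \<tau>(2) br_minus by simp
  qed
  have "(- \<tau>) ^ (2 * \<rho>) = 1" using \<tau>(1) by (simp add: power_mult power2_eq_square)
  then have 1: "(\<Prod>s=1..2*\<rho>. br ((\<omega> r - - \<delta>) / 2 + \<mu>' s)) = (\<Prod>s=1..2*\<rho>. br ((\<omega> r - \<delta>) / 2 + \<mu> s))"
  proof -
    have "(\<Prod>s=1..2*\<rho>. br ((\<omega> r - - \<delta>) / 2 + \<mu>' s)) = (\<Prod>s=1..2*\<rho>. - \<tau> * br ((\<omega> r - \<delta>) / 2 + \<mu> s))"
      by (intro prod.cong refl flip)
    then show ?thesis unfolding prod.distrib prod_constant card_atLeastAtMost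
      using \<open>(- \<tau>) ^ (2 * \<rho>) = 1\<close> by simp
  qed
  have "br (\<omega> r + - \<kappa> - - \<delta>) = \<tau> * br (- (\<kappa> - \<delta>))"
    unfolding \<tau>(2)[symmetric] by (simp add: algebra_simps)
  moreover have "br (\<omega> r + \<kappa> - \<delta>) = \<tau> * br (\<kappa> - \<delta>)"
    unfolding \<tau>(2)[symmetric] by (simp add: algebra_simps)
  ultimately have 2: "br (- \<kappa>) * X * br (\<omega> r + - \<kappa> - - \<delta>) = br \<kappa> * X * br (\<omega> r + \<kappa> - \<delta>)" for X
    unfolding br_minus by simp
  have 3: "pm br ((\<omega> r - - \<delta>) / 2) v (- c) = pm br ((\<omega> r - \<delta>) / 2) v c" for v c
    using pm_half_period_even[OF r, of "- \<delta> / 2" v c] by (simp add: diff_divide_distrib add_divide_distrib)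
  show ?thesis
    unfolding A_zero_eq 1 2 3 using 3[of _ 0] by simp
qed

text \<open>
  Negating all parameters interchanges the coefficients of the forward and the backward shifts, and
  also the shifts themselves. The constant terms are preserved because the bracket has a parity about
  each half period and the denominator $[\kappa][\omega_r+\kappa-\delta]$ changes sign twice.
\<close>

lemma ruijsenaars_BC_reflect:
  assumes "\<And>s. s \<in> {1..2*\<rho>} \<Longrightarrow> \<mu>' s = - \<mu> s"
  shows "ruijsenaars_BC \<rho> \<omega> br \<mu>' (- \<delta>) (- \<kappa>) N f x = ruijsenaars_BC \<rho> \<omega> br \<mu> \<delta> \<kappa> N f x"
proof -
  have "A_plus \<rho> \<omega> br \<mu>' (- \<delta>) (- \<kappa>) N i (\<lambda>j. - x j) = A_plus \<rho> \<omega> br \<mu> \<delta> \<kappa> N i x" for i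
    using A_plus_reflect[OF assms, where \<delta> = \<delta> and \<kappa> = \<kappa> and N = N and i = i and x = "\<lambda>j. - x j"] by simp
  moreover have "A_plus \<rho> \<omega> br \<mu>' (- \<delta>) (- \<kappa>) N i x = A_plus \<rho> \<omega> br \<mu> \<delta> \<kappa> N i (\<lambda>j. - x j)" for i
    by (rule A_plus_reflect[OF assms])
  moreover have "A_zero \<rho> \<omega> br \<mu>' (- \<delta>) (- \<kappa>) N r x = A_zero \<rho> \<omega> br \<mu> \<delta> \<kappa> N r x"
    if "r \<in> {1..\<rho>}" for r
    using A_zero_reflect[OF assms that] by simp
  ultimately show ?thesis
    unfolding ruijsenaars_BC_def A_minus_def
    by (simp add: algebra_simps)
qed

lemma pm_shift:
  assumes "a + c = a' + c'"
  shows "pm f a b c = pm f a' b c'"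
proof -
  have "a + b + c = a' + b + c'" "a - b + c = a' - b + c'" using assms by (simp_all add: algebra_simps)
  then show ?thesis by (simp only: pm_def)
qed

text \<open>
  At the half periods, the factors of one group of variables drop out of the coefficients that belong to
  the other group.
\<close>

lemma pm_quotient_at_half_period:
  assumes r: "r \<in> {1..\<rho>}" and nz: "br (2 * v - c) \<noteq> 0" "br (- (2 * v) - c) \<noteq> 0"
  shows "pm br (\<omega> r / 2 - c / 2) v c / pm br (\<omega> r / 2 - c / 2) v 0 = 1"
proof -
  have "pm br (\<omega> r / 2 - c / 2) v c = pm br (\<omega> r / 2 + c / 2) v 0"
    by (rule pm_shift) simp
  also have "\<dots> = pm br (\<omega> r / 2 - c / 2) v 0"
    using pm_half_period_even[OF r, of "c / 2" v 0] by simp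
  finally have *: "pm br (\<omega> r / 2 - c / 2) v c = pm br (\<omega> r / 2 - c / 2) v 0" .
  have "br (\<omega> r / 2 + (v - c / 2)) \<noteq> 0" "br (\<omega> r / 2 + (- v - c / 2)) \<noteq> 0"
    using br_half_period_nonzero(2)[OF r, of "v - c / 2"] br_half_period_nonzero(2)[OF r, of "- v - c / 2"] nz
    by (simp_all add: right_diff_distrib)
  then have "pm br (\<omega> r / 2 - c / 2) v 0 \<noteq> 0" by (simp add: pm_def algebra_simps)
  then show ?thesis unfolding * by simp
qed

section \<open>The source identity\<close>

text \<open>
  Together with $[\kappa-\delta]\ne0$, which separates the half periods from their translates, this makes
  all poles in the source identity distinct. It is stronger than regularity of
  the two operators: it also keeps \<open>x\<close>-poles away from \<open>y\<close>-poles and each group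
  away from the half-period poles of the other.
\<close>

definition separated :: "complex \<Rightarrow> complex \<Rightarrow> complex \<Rightarrow> nat \<Rightarrow> nat \<Rightarrow>
    (nat \<Rightarrow> complex) \<Rightarrow> (nat \<Rightarrow> complex) \<Rightarrow> bool" where
  "separated \<delta> \<kappa> \<epsilon> m n x y \<longleftrightarrow>
     (\<forall>i\<in>{1..m}. \<forall>v\<in>{0, \<delta>, - \<delta>, \<kappa>, - \<kappa>}. br (2 * x i + v) \<noteq> 0) \<and>
     (\<forall>l\<in>{1..n}. \<forall>v\<in>{0, \<epsilon>, - \<epsilon>, \<epsilon> + \<kappa> - \<delta>, - (\<epsilon> + \<kappa> - \<delta>)}. br (2 * y l + v) \<noteq> 0) \<and>
     (\<forall>i\<in>{1..m}. \<forall>j\<in>{1..m}. i \<noteq> j \<longrightarrow> pm br (x i) (x j) 0 \<noteq> 0) \<and>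
     (\<forall>k\<in>{1..n}. \<forall>l\<in>{1..n}. k \<noteq> l \<longrightarrow> pm br (y k) (y l) 0 \<noteq> 0) \<and>
     (\<forall>i\<in>{1..m}. \<forall>l\<in>{1..n}. \<forall>v\<in>{(\<delta> - \<epsilon>) / 2, - (\<delta> - \<epsilon>) / 2}. pm br (x i) (y l) v \<noteq> 0)"

text \<open>
  The partial fraction identity for the function displayed at the top of this text. In the residue at
  $x_i+\frac12\delta$ the factor $[2x_i+\kappa]$ cancels against the half-period poles
  $\frac12(\omega_r+\delta-\kappa)$, and in the residue at $y_l+\frac12\epsilon$ the factor
  $[2y_l+\epsilon]$ cancels against the half periods; what remains are the coefficients of the two operators.
\<close>

lemma source_identity:
  fixes x y \<mu> \<mu>' :: "nat \<Rightarrow> complex" and \<delta> \<kappa> \<epsilon> \<delta>' :: complex and m n :: nat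
  defines "X \<equiv> \<lambda>z. \<Prod>l=1..n. pm br z (y l) ((\<delta> + \<epsilon>) / 2) / pm br z (y l) ((\<delta> - \<epsilon>) / 2)"
    and "Y \<equiv> \<lambda>z. \<Prod>i=1..m. pm br z (x i) (\<kappa> + (\<epsilon> - \<delta>) / 2) / pm br z (x i) ((\<epsilon> - \<delta>) / 2)"
  assumes sep: "separated \<delta> \<kappa> \<epsilon> m n x y"
    and \<kappa>: "br \<kappa> \<noteq> 0" and \<epsilon>: "br \<epsilon> \<noteq> 0" and d: "br (\<kappa> - \<delta>) \<noteq> 0"
    and \<mu>': "\<And>s. s \<in> {1..2*\<rho>} \<Longrightarrow> \<mu>' s = \<mu> s + (\<epsilon> - \<delta>) / 2" and \<delta>': "\<delta>' = \<epsilon> + \<kappa> - \<delta>"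
  shows "br \<kappa> * ((\<Sum>i=1..m. A_plus \<rho> \<omega> br \<mu> \<delta> \<kappa> m i x * X (x i))
              + (\<Sum>i=1..m. A_minus \<rho> \<omega> br \<mu> \<delta> \<kappa> m i x * X (- x i))
              + (\<Sum>r=1..\<rho>. A_zero \<rho> \<omega> br \<mu> \<delta> \<kappa> m r x))
       + br \<epsilon> * ((\<Sum>l=1..n. A_plus \<rho> \<omega> br \<mu>' \<delta>' \<epsilon> n l y * Y (y l))
              + (\<Sum>l=1..n. A_minus \<rho> \<omega> br \<mu>' \<delta>' \<epsilon> n l y * Y (- y l))
              + (\<Sum>r=1..\<rho>. A_zero \<rho> \<omega> br \<mu>' \<delta>' \<epsilon> n r y))
       = br (2 * of_nat m * \<kappa> + 2 * of_nat n * \<epsilon> + c_const \<rho> \<omega> \<mu> \<delta> \<kappa>)"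
proof -
  \<comment> \<open>The left summand indexes the variables \<open>x\<close>, the right one the variables \<open>y\<close>.\<close>
  define P where "P = {1..m} <+> {1..n}"
  define w where "w = case_sum x y"
  define e :: "nat + nat \<Rightarrow> complex" where "e = case_sum (\<lambda>_. \<delta> / 2) (\<lambda>_. \<epsilon> / 2)"
  define h :: "nat + nat \<Rightarrow> complex" where "h = case_sum (\<lambda>_. \<kappa>) (\<lambda>_. \<epsilon>)"
  define a where "a s = \<delta> / 2 - \<mu> s" for s
  define d where "d = \<delta> - \<kappa>"
  have simps [simp]: "w (Inl i) = x i" "w (Inr i) = y i" "e (Inl i) = \<delta> / 2" "e (Inr i) = \<epsilon> / 2"
    "h (Inl i) = \<kappa>" "h (Inr i) = \<epsilon>" for i by (simp_all add: w_def e_def h_def)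
  have diff_Inl: "P - {Inl k} = ({1..m} - {k}) <+> {1..n}" for k by (auto simp: P_def)
  have diff_Inr: "P - {Inr k} = {1..m} <+> ({1..n} - {k})" for k by (auto simp: P_def)
  define U where "U i z = dup_const ^ 2 * (\<Prod>s=1..2*\<rho>. br (z + e i - a s))
      / (br (2 * (z + e i)) * br (2 * (z + e i) - d)) * (br (2 * z + h i) / br (2 * z))
      * (\<Prod>j\<in>P - {i}. pm br (z + e i - e j) (w j) (h j) / pm br (z + e i - e j) (w j) 0)" for i z
  have xx: "br (2 * x i + v) \<noteq> 0" if "i \<in> {1..m}" "v \<in> {0, \<delta>, - \<delta>, \<kappa>, - \<kappa>}" for i v
    using sep that unfolding separated_def by blast
  have yy: "br (2 * y l + v) \<noteq> 0" if "l \<in> {1..n}" "v \<in> {0, \<epsilon>, - \<epsilon>, \<epsilon> + \<kappa> - \<delta>, - (\<epsilon> + \<kappa> - \<delta>)}" for l v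
    using sep that unfolding separated_def by blast
  have xx': "br (2 * z + v) \<noteq> 0" if "i \<in> {1..m}" "v \<in> {0, \<delta>, - \<delta>, \<kappa>, - \<kappa>}" "z \<in> {x i, - x i}" for i v z
  proof -
    have "br (2 * x i + v) \<noteq> 0" by (rule xx[OF that(1,2)])
    moreover have "br (2 * x i + (- v)) \<noteq> 0" by (rule xx[OF that(1)]) (use that(2) in auto)
    moreover have "br (2 * - x i + v) = - br (2 * x i + (- v))"
      unfolding br_minus[symmetric] by simp
    ultimately show ?thesis using that(3) by auto
  qed
  have yy': "br (2 * z + v) \<noteq> 0"
    if "l \<in> {1..n}" "v \<in> {0, \<epsilon>, - \<epsilon>, \<epsilon> + \<kappa> - \<delta>, - (\<epsilon> + \<kappa> - \<delta>)}" "z \<in> {y l, - y l}" for l v z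
  proof -
    have "br (2 * y l + v) \<noteq> 0" by (rule yy[OF that(1,2)])
    moreover have "br (2 * y l + (- v)) \<noteq> 0" by (rule yy[OF that(1)]) (use that(2) in auto)
    moreover have "br (2 * - y l + v) = - br (2 * y l + (- v))"
      unfolding br_minus[symmetric] by simp
    ultimately show ?thesis using that(3) by auto
  qed
  have xx'': "pm br z (x j) 0 \<noteq> 0" if "i \<in> {1..m}" "j \<in> {1..m}" "i \<noteq> j" "z \<in> {x i, - x i}" for i j z
  proof -
    have "pm br (x i) (x j) 0 \<noteq> 0" using sep that unfolding separated_def by blast
    then show ?thesis using that pm_minus[of "x i" "x j" 0] by auto
  qed
  have yy'': "pm br z (y j) 0 \<noteq> 0" if "i \<in> {1..n}" "j \<in> {1..n}" "i \<noteq> j" "z \<in> {y i, - y i}" for i j z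
  proof -
    have "pm br (y i) (y j) 0 \<noteq> 0" using sep that unfolding separated_def by blast
    then show ?thesis using that pm_minus[of "y i" "y j" 0] by auto
  qed
  have xy0: "pm br (x i) (y l) v \<noteq> 0"
    if "i \<in> {1..m}" "l \<in> {1..n}" "v \<in> {(\<delta> - \<epsilon>) / 2, - (\<delta> - \<epsilon>) / 2}" for i l v
    using sep that unfolding separated_def by blast
  have xy: "pm br z (y l) v \<noteq> 0"
    if "i \<in> {1..m}" "l \<in> {1..n}" "z \<in> {x i, - x i}" "v \<in> {(\<delta> - \<epsilon>) / 2, - (\<delta> - \<epsilon>) / 2}" for i l z v
  proof -
    have "pm br (x i) (y l) v \<noteq> 0" by (rule xy0[OF that(1,2,4)])
    moreover have "pm br (x i) (y l) (- v) \<noteq> 0" by (rule xy0[OF that(1,2)]) (use that(4) in auto)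
    ultimately show ?thesis using that(3) pm_minus[of "x i" "y l" "- v"] by auto
  qed
  have yx: "pm br z (x i) v \<noteq> 0"
    if "i \<in> {1..m}" "l \<in> {1..n}" "z \<in> {y l, - y l}" "v \<in> {(\<delta> - \<epsilon>) / 2, - (\<delta> - \<epsilon>) / 2}" for i l z v
  proof -
    have "pm br (x i) (y l) v \<noteq> 0" "pm br (- x i) (y l) v \<noteq> 0"
      using xy[of i l _ v] that by auto
    then have "br (x i + y l + v) \<noteq> 0" "br (x i - y l + v) \<noteq> 0" "br (- x i + y l + v) \<noteq> 0" "br (- x i - y l + v) \<noteq> 0"
      by (auto simp: pm_def)
    then show ?thesis using that by (auto simp: pm_def algebra_simps)
  qed
  have "(\<Sum>r=1..\<rho>. (\<Prod>s=1..2*\<rho>. br (\<omega> r / 2 - a s))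
            / ((\<Prod>s\<in>{1..\<rho>} - {r}. br ((\<omega> r - \<omega> s) / 2)) * (br (\<omega> r - d) / dup_const))
            * (\<Prod>i\<in>P. pm br (\<omega> r / 2 - e i) (w i) (h i) / pm br (\<omega> r / 2 - e i) (w i) 0))
       + (\<Sum>r=1..\<rho>. (\<Prod>s=1..2*\<rho>. br ((\<omega> r + d) / 2 - a s))
            / ((\<Prod>s\<in>{1..\<rho>} - {r}. br ((\<omega> r - \<omega> s) / 2)) * (br (\<omega> r + d) / dup_const))
            * (\<Prod>i\<in>P. pm br ((\<omega> r + d) / 2 - e i) (w i) (h i) / pm br ((\<omega> r + d) / 2 - e i) (w i) 0))
       + (\<Sum>i\<in>P. br (h i) * (U i (w i) + U i (- w i)))
       = br ((\<Sum>r=1..\<rho>. \<omega> r) + of_nat \<rho> / 2 * d - (\<Sum>s=1..2*\<rho>. a s) + 2 * (\<Sum>i\<in>P. h i))"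
    unfolding U_def
  proof (rule symmetric_partial_fraction)
    show "finite P" by (simp add: P_def)
    show "br d \<noteq> 0" using d br_minus_eq_0_iff by (simp add: d_def)
  next
    fix i assume "i \<in> P"
    then show "br (2 * w i) \<noteq> 0" using xx[of _ 0] yy[of _ 0] by (auto simp: P_def)
  next
    fix i z assume "i \<in> P" "z \<in> {w i, - w i}"
    then consider (x) i' where "i = Inl i'" "i' \<in> {1..m}" "z \<in> {x i', - x i'}"
      | (y) i' where "i = Inr i'" "i' \<in> {1..n}" "z \<in> {y i', - y i'}" unfolding P_def by force
    then show "br (2 * (z + e i)) \<noteq> 0 \<and> br (2 * (z + e i) - d) \<noteq> 0"
    proof cases
      case x
      then show ?thesis using xx'[of i' \<delta> z] xx'[of i' \<kappa> z] by (simp add: d_def algebra_simps)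
    next
      case y
      then show ?thesis using yy'[of i' \<epsilon> z] yy'[of i' "\<epsilon> + \<kappa> - \<delta>" z] by (simp add: d_def algebra_simps)
    qed
  next
    fix i j z assume *: "i \<in> P" "j \<in> P" "i \<noteq> j" "z \<in> {w i, - w i}"
    show "pm br (z + e i - e j) (w j) 0 \<noteq> 0"
      using *(1)[unfolded P_def] *(2)[unfolded P_def]
    proof (elim PlusE)
      fix i' j' assume "i' \<in> {1..m}" "j' \<in> {1..m}" "i = Inl i'" "j = Inl j'"
      then show ?thesis using xx''[of i' j' z] * by simp
    next
      fix i' j' assume "i' \<in> {1..n}" "j' \<in> {1..n}" "i = Inr i'" "j = Inr j'"
      then show ?thesis using yy''[of i' j' z] * by simp
    next
      fix i' j' assume ij: "i' \<in> {1..m}" "j' \<in> {1..n}" "i = Inl i'" "j = Inr j'"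
      have "pm br (z + e i - e j) (w j) 0 = pm br z (y j') ((\<delta> - \<epsilon>) / 2)"
        using ij by (simp, intro pm_shift) (simp add: diff_divide_distrib)
      then show ?thesis using xy[of i' j' z] * ij by simp
    next
      fix i' j' assume ij: "i' \<in> {1..n}" "j' \<in> {1..m}" "i = Inr i'" "j = Inl j'"
      have "pm br (z + e i - e j) (w j) 0 = pm br z (x j') (- (\<delta> - \<epsilon>) / 2)"
        using ij by (simp, intro pm_shift) (simp add: diff_divide_distrib)
      then show ?thesis using yx[of j' i' z] * ij by simp
    qed
  qed
  moreover have "(\<Sum>r=1..\<rho>. \<omega> r) + of_nat \<rho> / 2 * d - (\<Sum>s=1..2*\<rho>. a s) + 2 * (\<Sum>i\<in>P. h i)
      = 2 * of_nat m * \<kappa> + 2 * of_nat n * \<epsilon> + c_const \<rho> \<omega> \<mu> \<delta> \<kappa>"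
  proof -
    have sum_a: "(\<Sum>s=1..2*\<rho>. a s) = of_nat \<rho> * \<delta> - (\<Sum>s=1..2*\<rho>. \<mu> s)"
      by (simp add: a_def sum_subtractf)
    show ?thesis
      unfolding sum_a by (simp add: P_def sum.Plus d_def c_const_def field_simps)
  qed
  moreover have "(\<Sum>r=1..\<rho>. (\<Prod>s=1..2*\<rho>. br (\<omega> r / 2 - a s))
            / ((\<Prod>s\<in>{1..\<rho>} - {r}. br ((\<omega> r - \<omega> s) / 2)) * (br (\<omega> r - d) / dup_const))
            * (\<Prod>i\<in>P. pm br (\<omega> r / 2 - e i) (w i) (h i) / pm br (\<omega> r / 2 - e i) (w i) 0))
      = br \<kappa> * (\<Sum>r=1..\<rho>. A_zero \<rho> \<omega> br \<mu> \<delta> \<kappa> m r x)"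
    unfolding sum_distrib_left
  proof (rule sum.cong[OF refl])
    fix r assume r: "r \<in> {1..\<rho>}"
    have "pm br (\<omega> r / 2 - \<epsilon> / 2) (y l) \<epsilon> / pm br (\<omega> r / 2 - \<epsilon> / 2) (y l) 0 = 1" if "l \<in> {1..n}" for l
      using yy'[OF that, of "- \<epsilon>" "y l"] yy'[OF that, of "- \<epsilon>" "- y l"]
      by (intro pm_quotient_at_half_period[OF r]) auto
    then have H: "(\<Prod>i\<in>P. pm br (\<omega> r / 2 - e i) (w i) (h i) / pm br (\<omega> r / 2 - e i) (w i) 0)
        = (\<Prod>j=1..m. pm br ((\<omega> r - \<delta>) / 2) (x j) \<kappa> / pm br ((\<omega> r - \<delta>) / 2) (x j) 0)"
      by (simp add: P_def prod.Plus diff_divide_distrib)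
    have N: "\<omega> r / 2 - a s = (\<omega> r - \<delta>) / 2 + \<mu> s" for s by (simp add: a_def diff_divide_distrib)
    have D: "\<omega> r - d = \<omega> r + \<kappa> - \<delta>" by (simp add: d_def)
    show "(\<Prod>s=1..2*\<rho>. br (\<omega> r / 2 - a s))
            / ((\<Prod>s\<in>{1..\<rho>} - {r}. br ((\<omega> r - \<omega> s) / 2)) * (br (\<omega> r - d) / dup_const))
            * (\<Prod>i\<in>P. pm br (\<omega> r / 2 - e i) (w i) (h i) / pm br (\<omega> r / 2 - e i) (w i) 0)
        = br \<kappa> * A_zero \<rho> \<omega> br \<mu> \<delta> \<kappa> m r x"
      using \<kappa> dup_nonzero unfolding A_zero_eq H N unfolding D by (simp add: mult_ac)
  qed
  moreover have "(\<Sum>r=1..\<rho>. (\<Prod>s=1..2*\<rho>. br ((\<omega> r + d) / 2 - a s))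
            / ((\<Prod>s\<in>{1..\<rho>} - {r}. br ((\<omega> r - \<omega> s) / 2)) * (br (\<omega> r + d) / dup_const))
            * (\<Prod>i\<in>P. pm br ((\<omega> r + d) / 2 - e i) (w i) (h i) / pm br ((\<omega> r + d) / 2 - e i) (w i) 0))
      = br \<epsilon> * (\<Sum>r=1..\<rho>. A_zero \<rho> \<omega> br \<mu>' \<delta>' \<epsilon> n r y)"
    unfolding sum_distrib_left
  proof (rule sum.cong[OF refl])
    fix r assume r: "r \<in> {1..\<rho>}"
    have half: "(\<omega> r + d) / 2 - \<delta> / 2 = \<omega> r / 2 - \<kappa> / 2" "(\<omega> r + d) / 2 - \<epsilon> / 2 = (\<omega> r - \<delta>') / 2"
      by (simp_all add: d_def \<delta>' field_simps)
    have "pm br (\<omega> r / 2 - \<kappa> / 2) (x i) \<kappa> / pm br (\<omega> r / 2 - \<kappa> / 2) (x i) 0 = 1" if "i \<in> {1..m}" for i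
      using xx'[OF that, of "- \<kappa>" "x i"] xx'[OF that, of "- \<kappa>" "- x i"]
      by (intro pm_quotient_at_half_period[OF r]) auto
    then have H: "(\<Prod>i\<in>P. pm br ((\<omega> r + d) / 2 - e i) (w i) (h i) / pm br ((\<omega> r + d) / 2 - e i) (w i) 0)
        = (\<Prod>j=1..n. pm br ((\<omega> r - \<delta>') / 2) (y j) \<epsilon> / pm br ((\<omega> r - \<delta>') / 2) (y j) 0)"
      by (simp add: P_def prod.Plus half)
    have N: "(\<Prod>s=1..2*\<rho>. br ((\<omega> r + d) / 2 - a s)) = (\<Prod>s=1..2*\<rho>. br ((\<omega> r - \<delta>') / 2 + \<mu>' s))"
      by (intro prod.cong refl arg_cong[of _ _ br]) (simp add: a_def d_def \<delta>' \<mu>' field_simps)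
    have D: "\<omega> r + d = \<omega> r + \<epsilon> - \<delta>'" by (simp add: d_def \<delta>')
    show "(\<Prod>s=1..2*\<rho>. br ((\<omega> r + d) / 2 - a s))
            / ((\<Prod>s\<in>{1..\<rho>} - {r}. br ((\<omega> r - \<omega> s) / 2)) * (br (\<omega> r + d) / dup_const))
            * (\<Prod>i\<in>P. pm br ((\<omega> r + d) / 2 - e i) (w i) (h i) / pm br ((\<omega> r + d) / 2 - e i) (w i) 0)
        = br \<epsilon> * A_zero \<rho> \<omega> br \<mu>' \<delta>' \<epsilon> n r y"
      using \<epsilon> dup_nonzero unfolding A_zero_eq H N unfolding D by (simp add: mult_ac)
  qed
  moreover have "(\<Sum>i\<in>P. br (h i) * (U i (w i) + U i (- w i)))
      = br \<kappa> * ((\<Sum>i=1..m. A_plus \<rho> \<omega> br \<mu> \<delta> \<kappa> m i x * X (x i))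
              + (\<Sum>i=1..m. A_minus \<rho> \<omega> br \<mu> \<delta> \<kappa> m i x * X (- x i)))
      + br \<epsilon> * ((\<Sum>l=1..n. A_plus \<rho> \<omega> br \<mu>' \<delta>' \<epsilon> n l y * Y (y l))
              + (\<Sum>l=1..n. A_minus \<rho> \<omega> br \<mu>' \<delta>' \<epsilon> n l y * Y (- y l)))"
  proof -
    \<comment> \<open>The choices \<open>\<xi> = x\<close> and \<open>\<xi> = - x\<close> give the two kinds of shifts at once.\<close>
    have Ux: "U (Inl i) (\<xi> i) = A_plus \<rho> \<omega> br \<mu> \<delta> \<kappa> m i \<xi> * X (\<xi> i)"
      if "i \<in> {1..m}" "\<xi> = x \<or> \<xi> = (\<lambda>j. - x j)" for i \<xi>
    proof -
      have "(\<Prod>j\<in>P - {Inl i}. pm br (\<xi> i + \<delta> / 2 - e j) (w j) (h j) / pm br (\<xi> i + \<delta> / 2 - e j) (w j) 0)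
          = (\<Prod>j\<in>{1..m} - {i}. pm br (\<xi> i) (x j) \<kappa> / pm br (\<xi> i) (x j) 0)
            * (\<Prod>l=1..n. pm br (\<xi> i + \<delta> / 2 - \<epsilon> / 2) (y l) \<epsilon> / pm br (\<xi> i + \<delta> / 2 - \<epsilon> / 2) (y l) 0)"
        unfolding diff_Inl by (simp add: prod.Plus)
      also have "(\<Prod>j\<in>{1..m} - {i}. pm br (\<xi> i) (x j) \<kappa> / pm br (\<xi> i) (x j) 0)
          = (\<Prod>j\<in>{1..m} - {i}. pm br (\<xi> i) (\<xi> j) \<kappa> / pm br (\<xi> i) (\<xi> j) 0)"
        using that(2) by (auto simp: pm_minus_right)
      also have "(\<Prod>l=1..n. pm br (\<xi> i + \<delta> / 2 - \<epsilon> / 2) (y l) \<epsilon> / pm br (\<xi> i + \<delta> / 2 - \<epsilon> / 2) (y l) 0) = X (\<xi> i)"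
        unfolding X_def by (intro prod.cong refl arg_cong2[of _ _ _ _ "(/)"] pm_shift) (simp_all add: field_simps)
      finally have 1: "(\<Prod>j\<in>P - {Inl i}. pm br (\<xi> i + \<delta> / 2 - e j) (w j) (h j) / pm br (\<xi> i + \<delta> / 2 - e j) (w j) 0)
          = (\<Prod>j\<in>{1..m} - {i}. pm br (\<xi> i) (\<xi> j) \<kappa> / pm br (\<xi> i) (\<xi> j) 0) * X (\<xi> i)" .
      have 2: "\<xi> i + \<delta> / 2 - a s = \<xi> i + \<mu> s" for s by (simp add: a_def)
      have 3: "2 * (\<xi> i + \<delta> / 2) = 2 * \<xi> i + \<delta>" "2 * \<xi> i + \<delta> - d = 2 * \<xi> i + \<kappa>"
        by (simp_all add: d_def)
      have "br (2 * \<xi> i + \<kappa>) \<noteq> 0" using xx'[OF that(1), of \<kappa> "\<xi> i"] that(2) by auto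
      then show ?thesis unfolding U_def A_plus_eq simps 1 2 3 by (simp add: mult_ac)
    qed
    have Uy: "U (Inr i) (\<xi> i) = A_plus \<rho> \<omega> br \<mu>' \<delta>' \<epsilon> n i \<xi> * Y (\<xi> i)"
      if "i \<in> {1..n}" "\<xi> = y \<or> \<xi> = (\<lambda>j. - y j)" for i \<xi>
    proof -
      have "(\<Prod>j\<in>P - {Inr i}. pm br (\<xi> i + \<epsilon> / 2 - e j) (w j) (h j) / pm br (\<xi> i + \<epsilon> / 2 - e j) (w j) 0)
          = (\<Prod>j=1..m. pm br (\<xi> i + \<epsilon> / 2 - \<delta> / 2) (x j) \<kappa> / pm br (\<xi> i + \<epsilon> / 2 - \<delta> / 2) (x j) 0)
            * (\<Prod>j\<in>{1..n} - {i}. pm br (\<xi> i) (y j) \<epsilon> / pm br (\<xi> i) (y j) 0)"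
        unfolding diff_Inr by (simp add: prod.Plus)
      also have "(\<Prod>j\<in>{1..n} - {i}. pm br (\<xi> i) (y j) \<epsilon> / pm br (\<xi> i) (y j) 0)
          = (\<Prod>j\<in>{1..n} - {i}. pm br (\<xi> i) (\<xi> j) \<epsilon> / pm br (\<xi> i) (\<xi> j) 0)"
        using that(2) by (auto simp: pm_minus_right)
      also have "(\<Prod>j=1..m. pm br (\<xi> i + \<epsilon> / 2 - \<delta> / 2) (x j) \<kappa> / pm br (\<xi> i + \<epsilon> / 2 - \<delta> / 2) (x j) 0) = Y (\<xi> i)"
        unfolding Y_def by (intro prod.cong refl arg_cong2[of _ _ _ _ "(/)"] pm_shift) (simp_all add: field_simps)
      finally have 1: "(\<Prod>j\<in>P - {Inr i}. pm br (\<xi> i + \<epsilon> / 2 - e j) (w j) (h j) / pm br (\<xi> i + \<epsilon> / 2 - e j) (w j) 0)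
          = Y (\<xi> i) * (\<Prod>j\<in>{1..n} - {i}. pm br (\<xi> i) (\<xi> j) \<epsilon> / pm br (\<xi> i) (\<xi> j) 0)" .
      have 2: "(\<Prod>s=1..2*\<rho>. br (\<xi> i + \<epsilon> / 2 - a s)) = (\<Prod>s=1..2*\<rho>. br (\<xi> i + \<mu>' s))"
        by (intro prod.cong refl arg_cong[of _ _ br]) (simp add: a_def \<mu>' field_simps)
      have 3: "2 * (\<xi> i + \<epsilon> / 2) = 2 * \<xi> i + \<epsilon>" "2 * \<xi> i + \<epsilon> - d = 2 * \<xi> i + \<delta>'"
        by (simp_all add: d_def \<delta>')
      have "br (2 * \<xi> i + \<epsilon>) \<noteq> 0" using yy'[OF that(1), of \<epsilon> "\<xi> i"] that(2) by auto
      then show ?thesis unfolding U_def A_plus_eq simps 1 2 3 by (simp add: mult_ac)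
    qed
    show ?thesis
      using Ux[of _ x] Ux[of _ "\<lambda>j. - x j"] Uy[of _ y] Uy[of _ "\<lambda>j. - y j"]
      by (simp add: P_def sum.Plus A_minus_def sum_distrib_left distrib_left sum.distrib)
  qed
  ultimately show ?thesis by (simp add: algebra_simps)
qed

section \<open>Continuity and generic points\<close>

text \<open>
  Rewriting regularity without half periods shows that it is unchanged when \<open>\<delta>\<close> is replaced by
  \<open>-\<delta>\<close>, and reduces it to brackets of affine functions.
\<close>

lemma BC_regular_iff:
  "BC_regular \<rho> \<omega> br \<delta> N x \<longleftrightarrow>
     (\<forall>i\<in>{1..N}. \<forall>v\<in>{0, \<delta>, - \<delta>}. br (2 * x i + v) \<noteq> 0) \<and>
     (\<forall>i\<in>{1..N}. \<forall>j\<in>{1..N}. i \<noteq> j \<longrightarrow> pm br (x i) (x j) 0 \<noteq> 0)"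
proof -
  have prod_iff: "(\<forall>s\<in>{1..\<rho>}. br (u - \<omega> s / 2) \<noteq> 0) \<longleftrightarrow> br (2 * u) \<noteq> 0" for u
  proof -
    have "(\<forall>s\<in>{1..\<rho>}. br (u - \<omega> s / 2) \<noteq> 0) \<longleftrightarrow> (\<Prod>s=1..\<rho>. br (u - \<omega> s / 2)) \<noteq> 0" by simp
    then show ?thesis unfolding prod_half_periods using dup_nonzero by simp
  qed
  have denominators: "(\<forall>s\<in>{1..\<rho>}. br (u - \<omega> s / 2) \<noteq> 0 \<and> br (u + (\<delta> - \<omega> s) / 2) \<noteq> 0)
      \<longleftrightarrow> br (2 * u) \<noteq> 0 \<and> br (2 * u + \<delta>) \<noteq> 0" for u
  proof -
    have eq: "u + (\<delta> - \<omega> s) / 2 = (u + \<delta> / 2) - \<omega> s / 2" for s by (simp add: field_simps)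
    show ?thesis unfolding eq ball_conj_distrib prod_iff by (simp add: distrib_left)
  qed
  have plus: "A_plus_regular \<rho> \<omega> br \<delta> N i \<xi> \<longleftrightarrow> br (2 * \<xi> i) \<noteq> 0 \<and> br (2 * \<xi> i + \<delta>) \<noteq> 0 \<and>
     (\<forall>j\<in>{1..N}. i \<noteq> j \<longrightarrow> pm br (\<xi> i) (\<xi> j) 0 \<noteq> 0)" for i \<xi>
    unfolding A_plus_regular_def denominators by auto
  have neg: "br (2 * - x i) = - br (2 * x i)" "br (2 * - x i + \<delta>) = - br (2 * x i + - \<delta>)" for i
    by (simp_all add: br_minus[symmetric])
  have pm_neg: "pm br (- x i) (- x j) 0 = pm br (x i) (x j) 0" for i j
    using pm_minus[of "x i" "x j" 0] by (simp add: pm_minus_right)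
  have zero: "pm br ((\<omega> r - \<delta>) / 2) (x j) 0 \<noteq> 0"
    if "r \<in> {1..\<rho>}" "br (2 * x j + - \<delta>) \<noteq> 0" "br (2 * x j + \<delta>) \<noteq> 0" for r j
  proof -
    have "br (2 * (- \<delta> / 2 + x j)) \<noteq> 0" using that(2) by simp
    moreover have "br (2 * (- \<delta> / 2 - x j)) = - br (2 * x j + \<delta>)"
      unfolding br_minus[symmetric] by (simp add: algebra_simps)
    then have "br (2 * (- \<delta> / 2 - x j)) \<noteq> 0" using that(3) by simp
    ultimately have "br (\<omega> r / 2 + (- \<delta> / 2 + x j)) \<noteq> 0" "br (\<omega> r / 2 + (- \<delta> / 2 - x j)) \<noteq> 0"
      using br_half_period_nonzero(2)[OF that(1)] by blast+
    then show ?thesis by (simp add: pm_def diff_divide_distrib algebra_simps)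
  qed
  show ?thesis
    unfolding BC_regular_def plus neg pm_neg using zero by auto
qed

lemma isCont_br [continuous_intros]:
  assumes "isCont f a"
  shows "isCont (\<lambda>t. br (f t)) a"
proof -
  have "isCont br (f a)"
    using holomorphic_on_imp_continuous_on[OF holomorphic] by (simp add: continuous_on_eq_continuous_at)
  then show ?thesis using assms isCont_o2 by blast
qed

lemma isCont_pm_br [continuous_intros]:
  assumes "isCont f a" "isCont g a"
  shows "isCont (\<lambda>t. pm br (f t) (g t) c) a"
  unfolding pm_def by (intro continuous_intros assms)

lemma eventually_br_affine_nonzero:
  assumes "br \<alpha> \<noteq> 0 \<or> k \<noteq> 0"
  shows "\<forall>\<^sub>F t in at 0. br (\<alpha> + k * t) \<noteq> 0"
proof (cases "br \<alpha> = 0")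
  case True
  then have k: "k \<noteq> 0" using assms by simp
  obtain u where u: "br u \<noteq> 0" using nontrivial by blast
  have "(br \<circ> (\<lambda>t. \<alpha> + k * t)) holomorphic_on UNIV"
    by (intro holomorphic_on_compose holomorphic_intros holomorphic_on_subset[OF holomorphic]) auto
  then obtain r where "0 < r" "\<And>t. t \<in> ball 0 r - {0} \<Longrightarrow> (br \<circ> (\<lambda>t. \<alpha> + k * t)) t \<noteq> 0"
    using isolated_zeros[of "br \<circ> (\<lambda>t. \<alpha> + k * t)" UNIV 0 "(u - \<alpha>) / k"] k u True by (auto simp: o_def)
  then show ?thesis by (auto simp: eventually_at dist_commute intro!: exI[of _ r])
next
  case False
  have "isCont (\<lambda>t. br (\<alpha> + k * t)) 0" by (intro continuous_intros)
  then have "((\<lambda>t. br (\<alpha> + k * t)) \<longlongrightarrow> br \<alpha>) (at 0)" by (simp add: isCont_def)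
  then show ?thesis using False by (rule tendsto_imp_eventually_ne)
qed

lemma eventually_pm_br_nonzero:
  assumes "br (u + v + c) \<noteq> 0 \<or> a + b \<noteq> 0" "br (u - v + c) \<noteq> 0 \<or> a - b \<noteq> 0"
  shows "\<forall>\<^sub>F t in at 0. pm br (u + a * t) (v + b * t) c \<noteq> 0"
  using eventually_br_affine_nonzero[OF assms(1)] eventually_br_affine_nonzero[OF assms(2)]
  by eventually_elim (simp add: pm_def algebra_simps)

text \<open>
  The speeds 1 and 2 of \<open>x\<close> and \<open>y\<close> are chosen so that $2x_i$, $2y_l$, $x_i\pm y_l$ and
  the sums $x_i+x_j$, $y_k+y_l$ all move. Only the differences $x_i-x_j$ and $y_k-y_l$ stay constant, and
  these are covered by regularity.
\<close>

lemma eventually_separated: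
  assumes x: "BC_regular \<rho> \<omega> br \<delta> m x" and y: "BC_regular \<rho> \<omega> br \<delta>' n y"
  shows "\<forall>\<^sub>F t in at 0. separated \<delta> \<kappa> \<epsilon> m n (\<lambda>j. x j + t) (\<lambda>l. y l + 2 * t)"
  unfolding separated_def
proof (intro eventually_conj eventually_ball_finite ballI finite_atLeastAtMost)
  have double: "\<forall>\<^sub>F t in at 0. br (2 * (u + k * t) + v) \<noteq> 0" if "k \<noteq> 0" for u v k
    using eventually_br_affine_nonzero[of "2 * u + v" "2 * k"] that by (simp add: algebra_simps)
  show "\<forall>\<^sub>F t in at 0. br (2 * (x i + t) + v) \<noteq> 0" for i v using double[of 1 "x i" v] by simp
  show "\<forall>\<^sub>F t in at 0. br (2 * (y i + 2 * t) + v) \<noteq> 0" for i v using double[of 2 "y i" v] by simp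
next
  fix i j assume ij: "i \<in> {1..m}" "j \<in> {1..m}"
  show "\<forall>\<^sub>F t in at 0. i \<noteq> j \<longrightarrow> pm br (x i + t) (x j + t) 0 \<noteq> 0"
  proof (cases "i = j")
    case False
    then have "br (x i - x j + 0) \<noteq> 0" using x ij unfolding BC_regular_iff pm_def by auto
    then show ?thesis using eventually_pm_br_nonzero[of "x i" "x j" 0 1 1] by simp
  qed simp
next
  fix i j assume ij: "i \<in> {1..n}" "j \<in> {1..n}"
  show "\<forall>\<^sub>F t in at 0. i \<noteq> j \<longrightarrow> pm br (y i + 2 * t) (y j + 2 * t) 0 \<noteq> 0"
  proof (cases "i = j")
    case False
    then have "br (y i - y j + 0) \<noteq> 0" using y ij unfolding BC_regular_iff pm_def by auto
    then show ?thesis using eventually_pm_br_nonzero[of "y i" "y j" 0 2 2] by simp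
  qed simp
next
  show "\<forall>\<^sub>F t in at 0. pm br (x i + t) (y l + 2 * t) v \<noteq> 0" for i l v
    using eventually_pm_br_nonzero[of "x i" "y l" v 1 2] by simp
qed auto

lemma isCont_A_plus:
  assumes "BC_regular \<rho> \<omega> br \<delta> N (X a)" "i \<in> {1..N}" "\<And>j. isCont (\<lambda>t. X t j) a"
  shows "isCont (\<lambda>t. A_plus \<rho> \<omega> br \<mu> \<delta> \<kappa> N i (X t)) a"
  unfolding A_plus_eq using assms(1,2) unfolding BC_regular_iff
  by (intro continuous_intros assms(3)) auto

lemma isCont_A_minus:
  assumes "BC_regular \<rho> \<omega> br \<delta> N (X a)" "i \<in> {1..N}" "\<And>j. isCont (\<lambda>t. X t j) a"
  shows "isCont (\<lambda>t. A_minus \<rho> \<omega> br \<mu> \<delta> \<kappa> N i (X t)) a"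
proof -
  have "BC_regular \<rho> \<omega> br \<delta> N (\<lambda>j. - X a j)"
    using assms(1) unfolding BC_regular_def by (auto simp: pm_minus_right)
  then show ?thesis unfolding A_minus_def
    using assms by (intro isCont_A_plus continuous_intros) auto
qed

lemma isCont_A_zero:
  assumes "BC_regular \<rho> \<omega> br \<delta> N (X a)" "r \<in> {1..\<rho>}" "\<And>j. isCont (\<lambda>t. X t j) a"
  shows "isCont (\<lambda>t. A_zero \<rho> \<omega> br \<mu> \<delta> \<kappa> N r (X t)) a"
  unfolding A_zero_def using assms(1,2) unfolding BC_regular_def
  by (intro continuous_intros assms(3)) auto

lemma isCont_ruijsenaars_BC:
  assumes "BC_regular \<rho> \<omega> br \<delta> N (X a)" "\<And>j. isCont (\<lambda>t. X t j) a"
    and "isCont (\<lambda>t. f t (X t)) a"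
    and "\<And>i. i \<in> {1..N} \<Longrightarrow> isCont (\<lambda>t. f t ((X t)(i := X t i + \<delta>))) a"
    and "\<And>i. i \<in> {1..N} \<Longrightarrow> isCont (\<lambda>t. f t ((X t)(i := X t i - \<delta>))) a"
  shows "isCont (\<lambda>t. ruijsenaars_BC \<rho> \<omega> br \<mu> \<delta> \<kappa> N (f t) (X t)) a"
  unfolding ruijsenaars_BC_def
  by (intro continuous_intros isCont_A_plus isCont_A_minus isCont_A_zero assms)

section \<open>From the source identity to kernel functions\<close>

text \<open>
  For a kernel function $\prod_{j,l} g(x_j,y_l)$, these equations for the factor \<open>g\<close> say that the
  shift quotients are those in the source identity. They are written with multiplication by the quotient,
  so that zeros of the kernel function are harmless.
\<close>

definition kernel_shifts :: "(complex \<Rightarrow> complex \<Rightarrow> complex) \<Rightarrow> complex \<Rightarrow> complex \<Rightarrow> complex \<Rightarrow>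
    complex \<Rightarrow> complex \<Rightarrow> bool" where
  "kernel_shifts g \<delta> \<kappa> \<epsilon> u v \<longleftrightarrow>
     g (u + \<delta>) v = g u v * (pm br u v ((\<delta> + \<epsilon>) / 2) / pm br u v ((\<delta> - \<epsilon>) / 2)) \<and>
     g (u - \<delta>) v = g u v * (pm br (- u) v ((\<delta> + \<epsilon>) / 2) / pm br (- u) v ((\<delta> - \<epsilon>) / 2)) \<and>
     g u (v + (\<epsilon> + \<kappa> - \<delta>)) = g u v * (pm br v u (\<kappa> + (\<epsilon> - \<delta>) / 2) / pm br v u ((\<epsilon> - \<delta>) / 2)) \<and>
     g u (v - (\<epsilon> + \<kappa> - \<delta>)) = g u v * (pm br (- v) u (\<kappa> + (\<epsilon> - \<delta>) / 2) / pm br (- v) u ((\<epsilon> - \<delta>) / 2))"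

lemma prod_prod_upd_left:
  fixes g :: "complex \<Rightarrow> complex \<Rightarrow> complex" and m n :: nat
  assumes i: "i \<in> {1..m}" and "\<And>l. l \<in> {1..n} \<Longrightarrow> g v (y l) = g (x i) (y l) * R l"
  shows "(\<Prod>j=1..m. \<Prod>l=1..n. g ((x(i := v)) j) (y l)) = (\<Prod>j=1..m. \<Prod>l=1..n. g (x j) (y l)) * (\<Prod>l=1..n. R l)"
proof -
  have "(\<Prod>l=1..n. g v (y l)) = (\<Prod>l=1..n. g (x i) (y l)) * (\<Prod>l=1..n. R l)"
    unfolding prod.distrib[symmetric] by (intro prod.cong refl assms(2))
  moreover have "(\<Prod>j=1..m. \<Prod>l=1..n. g ((x(i := v)) j) (y l))
      = (\<Prod>l=1..n. g v (y l)) * (\<Prod>j\<in>{1..m} - {i}. \<Prod>l=1..n. g (x j) (y l))"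
    using i by (subst prod.remove[of _ i]) auto
  moreover have "(\<Prod>j=1..m. \<Prod>l=1..n. g (x j) (y l))
      = (\<Prod>l=1..n. g (x i) (y l)) * (\<Prod>j\<in>{1..m} - {i}. \<Prod>l=1..n. g (x j) (y l))"
    using i by (subst prod.remove[of _ i]) auto
  ultimately show ?thesis by (simp add: mult_ac)
qed

lemma prod_prod_upd_right:
  fixes g :: "complex \<Rightarrow> complex \<Rightarrow> complex" and m n :: nat
  assumes "l \<in> {1..n}" "\<And>j. j \<in> {1..m} \<Longrightarrow> g (x j) v = g (x j) (y l) * R j"
  shows "(\<Prod>j=1..m. \<Prod>k=1..n. g (x j) ((y(l := v)) k)) = (\<Prod>j=1..m. \<Prod>k=1..n. g (x j) (y k)) * (\<Prod>j=1..m. R j)"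
  unfolding prod.swap[of _ "{1..n}" "{1..m}"]
  by (rule prod_prod_upd_left[of l n m "\<lambda>b a. g a b"]) (use assms in auto)

lemma kernel_identity_separated:
  fixes g :: "complex \<Rightarrow> complex \<Rightarrow> complex" and m n :: nat
  defines "F \<equiv> \<lambda>x y. \<Prod>j=1..m. \<Prod>l=1..n. g (x j) (y l)"
  assumes sep: "separated \<delta> \<kappa> \<epsilon> m n x y"
    and \<kappa>: "br \<kappa> \<noteq> 0" and \<epsilon>: "br \<epsilon> \<noteq> 0" and d: "br (\<kappa> - \<delta>) \<noteq> 0"
    and \<mu>': "\<And>s. s \<in> {1..2*\<rho>} \<Longrightarrow> \<mu>' s = \<mu> s + (\<epsilon> - \<delta>) / 2" and \<delta>': "\<delta>' = \<epsilon> + \<kappa> - \<delta>"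
    and g: "\<And>i l. i \<in> {1..m} \<Longrightarrow> l \<in> {1..n} \<Longrightarrow> kernel_shifts g \<delta> \<kappa> \<epsilon> (x i) (y l)"
  shows "br \<kappa> * ruijsenaars_BC \<rho> \<omega> br \<mu> \<delta> \<kappa> m (\<lambda>x. F x y) x + br \<epsilon> * ruijsenaars_BC \<rho> \<omega> br \<mu>' \<delta>' \<epsilon> n (F x) y
       = br (2 * of_nat m * \<kappa> + 2 * of_nat n * \<epsilon> + c_const \<rho> \<omega> \<mu> \<delta> \<kappa>) * F x y"
proof -
  define X where "X z = (\<Prod>l=1..n. pm br z (y l) ((\<delta> + \<epsilon>) / 2) / pm br z (y l) ((\<delta> - \<epsilon>) / 2))" for z
  define Y where "Y z = (\<Prod>i=1..m. pm br z (x i) (\<kappa> + (\<epsilon> - \<delta>) / 2) / pm br z (x i) ((\<epsilon> - \<delta>) / 2))" for z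
  define SX where "SX = (\<Sum>i=1..m. A_plus \<rho> \<omega> br \<mu> \<delta> \<kappa> m i x * X (x i))
              + (\<Sum>i=1..m. A_minus \<rho> \<omega> br \<mu> \<delta> \<kappa> m i x * X (- x i))
              + (\<Sum>r=1..\<rho>. A_zero \<rho> \<omega> br \<mu> \<delta> \<kappa> m r x)"
  define SY where "SY = (\<Sum>l=1..n. A_plus \<rho> \<omega> br \<mu>' \<delta>' \<epsilon> n l y * Y (y l))
              + (\<Sum>l=1..n. A_minus \<rho> \<omega> br \<mu>' \<delta>' \<epsilon> n l y * Y (- y l))
              + (\<Sum>r=1..\<rho>. A_zero \<rho> \<omega> br \<mu>' \<delta>' \<epsilon> n r y)"
  have "F (x(i := x i + \<delta>)) y = F x y * X (x i)" "F (x(i := x i - \<delta>)) y = F x y * X (- x i)"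
    if "i \<in> {1..m}" for i
    using g[OF that] that unfolding F_def X_def kernel_shifts_def by (blast intro: prod_prod_upd_left)+
  then have Ex: "ruijsenaars_BC \<rho> \<omega> br \<mu> \<delta> \<kappa> m (\<lambda>x. F x y) x
      = SX * F x y"
    unfolding ruijsenaars_BC_def SX_def
    by (simp add: distrib_left distrib_right sum_distrib_left sum_distrib_right mult_ac)
  have "F x (y(l := y l + \<delta>')) = F x y * Y (y l)" "F x (y(l := y l - \<delta>')) = F x y * Y (- y l)"
    if "l \<in> {1..n}" for l
    using g[OF _ that] that unfolding F_def Y_def kernel_shifts_def \<delta>' by (blast intro: prod_prod_upd_right)+
  then have Ey: "ruijsenaars_BC \<rho> \<omega> br \<mu>' \<delta>' \<epsilon> n (F x) y
      = SY * F x y"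
    unfolding ruijsenaars_BC_def SY_def
    by (simp add: distrib_left distrib_right sum_distrib_left sum_distrib_right mult_ac)
  have "br \<kappa> * (SX * F x y) + br \<epsilon> * (SY * F x y) = (br \<kappa> * SX + br \<epsilon> * SY) * F x y"
    by (simp only: distrib_right mult.assoc)
  also have "br \<kappa> * SX + br \<epsilon> * SY = br (2 * of_nat m * \<kappa> + 2 * of_nat n * \<epsilon> + c_const \<rho> \<omega> \<mu> \<delta> \<kappa>)"
    unfolding SX_def SY_def X_def Y_def by (rule source_identity[OF sep \<kappa> \<epsilon> d \<mu>' \<delta>'])
  finally show ?thesis unfolding Ex Ey .
qed

text \<open>
  Here the identity reaches the points at which poles collide. The shift relations are required only at
  nearby points of the line, since their denominators may vanish at the given point.
\<close>

lemma kernel_identity: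
  fixes g :: "complex \<Rightarrow> complex \<Rightarrow> complex" and m n :: nat
  defines "F \<equiv> \<lambda>x y. \<Prod>j=1..m. \<Prod>l=1..n. g (x j) (y l)"
  assumes x: "BC_regular \<rho> \<omega> br \<delta> m x" and y: "BC_regular \<rho> \<omega> br \<delta>' n y"
    and \<kappa>: "br \<kappa> \<noteq> 0" and \<epsilon>: "br \<epsilon> \<noteq> 0" and d: "br (\<kappa> - \<delta>) \<noteq> 0"
    and \<mu>': "\<And>s. s \<in> {1..2*\<rho>} \<Longrightarrow> \<mu>' s = \<mu> s + (\<epsilon> - \<delta>) / 2" and \<delta>': "\<delta>' = \<epsilon> + \<kappa> - \<delta>"
    and g: "\<And>i l. i \<in> {1..m} \<Longrightarrow> l \<in> {1..n} \<Longrightarrow>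
        \<forall>\<^sub>F t in at 0. kernel_shifts g \<delta> \<kappa> \<epsilon> (x i + t) (y l + 2 * t)"
    and cont: "\<And>i l u v. i \<in> {1..m} \<Longrightarrow> l \<in> {1..n} \<Longrightarrow>
        (u, v) \<in> {(x i, y l), (x i + \<delta>, y l), (x i - \<delta>, y l), (x i, y l + \<delta>'), (x i, y l - \<delta>')} \<Longrightarrow>
        isCont (\<lambda>t. g (u + t) (v + 2 * t)) 0"
  shows "br \<kappa> * ruijsenaars_BC \<rho> \<omega> br \<mu> \<delta> \<kappa> m (\<lambda>x. F x y) x + br \<epsilon> * ruijsenaars_BC \<rho> \<omega> br \<mu>' \<delta>' \<epsilon> n (F x) y
       = br (2 * of_nat m * \<kappa> + 2 * of_nat n * \<epsilon> + c_const \<rho> \<omega> \<mu> \<delta> \<kappa>) * F x y"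
proof -
  define X where "X t = (\<lambda>j. x j + t)" for t
  define Y where "Y t = (\<lambda>l. y l + 2 * t)" for t
  define D where "D t = br \<kappa> * ruijsenaars_BC \<rho> \<omega> br \<mu> \<delta> \<kappa> m (\<lambda>\<xi>. F \<xi> (Y t)) (X t)
      + br \<epsilon> * ruijsenaars_BC \<rho> \<omega> br \<mu>' \<delta>' \<epsilon> n (F (X t)) (Y t)
      - br (2 * of_nat m * \<kappa> + 2 * of_nat n * \<epsilon> + c_const \<rho> \<omega> \<mu> \<delta> \<kappa>) * F (X t) (Y t)" for t
  have [simp]: "X 0 = x" "Y 0 = y" by (auto simp: X_def Y_def)
  have contX: "isCont (\<lambda>t. X t j) 0" and contY: "isCont (\<lambda>t. Y t j) 0" for j
    by (auto simp: X_def Y_def intro!: continuous_intros)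
  have contF: "isCont (\<lambda>t. F (X t) (Y t)) 0"
    unfolding F_def X_def Y_def by (intro continuous_intros cont) auto
  have contFx: "isCont (\<lambda>t. F ((X t)(i := X t i + \<delta>)) (Y t)) 0"
      "isCont (\<lambda>t. F ((X t)(i := X t i - \<delta>)) (Y t)) 0" if "i \<in> {1..m}" for i
  proof -
    have "((X t)(i := X t i + \<delta>)) j = (if j = i then x i + \<delta> else x j) + t"
      "((X t)(i := X t i - \<delta>)) j = (if j = i then x i - \<delta> else x j) + t" for j t
      by (auto simp: X_def)
    then show "isCont (\<lambda>t. F ((X t)(i := X t i + \<delta>)) (Y t)) 0"
      "isCont (\<lambda>t. F ((X t)(i := X t i - \<delta>)) (Y t)) 0"
      unfolding F_def Y_def by (simp_all only:) (intro continuous_intros cont; auto)+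
  qed
  have contFy: "isCont (\<lambda>t. F (X t) ((Y t)(l := Y t l + \<delta>'))) 0"
      "isCont (\<lambda>t. F (X t) ((Y t)(l := Y t l - \<delta>'))) 0" if "l \<in> {1..n}" for l
  proof -
    have "((Y t)(l := Y t l + \<delta>')) j = (if j = l then y l + \<delta>' else y j) + 2 * t"
      "((Y t)(l := Y t l - \<delta>')) j = (if j = l then y l - \<delta>' else y j) + 2 * t" for j t
      by (auto simp: Y_def)
    then show "isCont (\<lambda>t. F (X t) ((Y t)(l := Y t l + \<delta>'))) 0"
      "isCont (\<lambda>t. F (X t) ((Y t)(l := Y t l - \<delta>'))) 0"
      unfolding F_def X_def by (simp_all only:) (intro continuous_intros cont; auto)+
  qed
  have "isCont D 0"
    unfolding D_def using x y
    by (intro continuous_intros isCont_ruijsenaars_BC contX contY contF contFx contFy) auto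
  moreover have "\<forall>\<^sub>F t in at 0. D t = 0"
  proof -
    have "\<forall>\<^sub>F t in at 0. \<forall>i\<in>{1..m}. \<forall>l\<in>{1..n}. kernel_shifts g \<delta> \<kappa> \<epsilon> (x i + t) (y l + 2 * t)"
      by (intro eventually_ball_finite ballI g) auto
    moreover have "\<forall>\<^sub>F t in at 0. separated \<delta> \<kappa> \<epsilon> m n (X t) (Y t)"
      unfolding X_def Y_def by (rule eventually_separated[OF x y])
    ultimately show ?thesis
    proof eventually_elim
      case (elim t)
      then show ?case
        using kernel_identity_separated[OF elim(2) \<kappa> \<epsilon> d \<mu>' \<delta>', where g = g]
        by (simp add: D_def F_def X_def Y_def)
    qed
  qed
  then have "(D \<longlongrightarrow> 0) (at 0)" by (rule tendsto_eventually)
  ultimately have "D 0 = 0" unfolding isCont_def by (rule tendsto_unique[rotated]) simp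
  then show ?thesis by (simp add: D_def)
qed

section \<open>The kernel functions\<close>

lemma pm_br_swap:
  "pm br a (b + d) 0 = - pm br b a d" "pm br a (b - d) 0 = - pm br (- b) a d"
proof -
  have "br (a + (b + d) + 0) = br (b + a + d)" "br (a - (b + d) + 0) = - br (b - a + d)"
    "br (a + (b - d) + 0) = - br (- b - a + d)" "br (a - (b - d) + 0) = br (- b + a + d)"
    unfolding br_minus[symmetric] by (simp_all add: algebra_simps)
  then show "pm br a (b + d) 0 = - pm br b a d" "pm br a (b - d) 0 = - pm br (- b) a d"
    by (simp_all only: pm_def) simp_all
qed

lemma pm_br_nonzero_signs:
  assumes "pm br u v c \<noteq> 0" "pm br u v (- c) \<noteq> 0"
  shows "pm br (- u) v c \<noteq> 0" "pm br v u c \<noteq> 0" "pm br (- v) u c \<noteq> 0"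
proof -
  have "br (- u + v + c) = - br (u - v + (- c))" "br (- u - v + c) = - br (u + v + (- c))"
    "br (v - u + c) = - br (u - v + (- c))" "br (- v - u + c) = - br (u + v + (- c))"
    "br (v + u + c) = br (u + v + c)" "br (- v + u + c) = br (u - v + c)"
    unfolding br_minus[symmetric] by (simp_all add: algebra_simps)
  then show "pm br (- u) v c \<noteq> 0" "pm br v u c \<noteq> 0" "pm br (- v) u c \<noteq> 0"
    using assms by (simp_all add: pm_def)
qed

lemma kernel_shifts_bracket:
  assumes "pm br u v 0 \<noteq> 0"
  shows "kernel_shifts (\<lambda>u v. pm br u v 0) \<delta> \<kappa> \<delta> u v"
proof -
  have "pm br (u + \<delta>) v 0 = pm br u v \<delta>" by (rule pm_shift) simp
  moreover have "pm br (u - \<delta>) v 0 = pm br (- u) v \<delta>"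
    using pm_shift[of "u - \<delta>" 0 u "- \<delta>" br v] pm_minus[of "- u" v \<delta>] by simp
  moreover have "pm br (- u) v 0 = pm br u v 0" using pm_minus[of u v 0] by simp
  moreover have "pm br v u 0 = - pm br u v 0" using pm_br_swap(1)[of u v 0] by simp
  moreover have "pm br (- v) u 0 = - pm br u v 0" using pm_br_swap(2)[of u v 0] by simp
  ultimately show ?thesis
    using assms pm_br_swap[of u v \<kappa>] by (simp add: kernel_shifts_def)
qed

text \<open>
  The difference equation is given away from a discrete set; it extends by continuity to every point
  at which both of its sides are analytic.
\<close>

lemma functional_equation_at:
  assumes G: "\<forall>\<^sub>\<approx>u\<in>UNIV. G (u + \<delta>) = c0 * br u * G u"
    and "G analytic_on {p}" "G analytic_on {p + \<delta>}"
  shows "G (p + \<delta>) = c0 * br p * G p"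
proof -
  have "\<forall>\<^sub>F u in at p. G (u + \<delta>) = c0 * br u * G u"
    using eventually_cosparse_imp_eventually_at[OF G, of p UNIV] by simp
  moreover have "isCont (\<lambda>u. c0 * br u * G u) p"
    using analytic_at_imp_isCont[OF assms(2)] by (intro continuous_intros)
  then have "((\<lambda>u. c0 * br u * G u) \<longlongrightarrow> c0 * br p * G p) (at p)" by (simp add: isCont_def)
  ultimately have "((\<lambda>u. G (u + \<delta>)) \<longlongrightarrow> c0 * br p * G p) (at p)"
    by (simp add: tendsto_cong)
  moreover have "isCont (\<lambda>u. G (u + \<delta>)) p"
    by (intro isCont_o2[where f = "\<lambda>u. u + \<delta>" and g = G] analytic_at_imp_isCont assms(3) continuous_intros)
  then have "((\<lambda>u. G (u + \<delta>)) \<longlongrightarrow> G (p + \<delta>)) (at p)" by (simp add: isCont_def)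
  ultimately show ?thesis by (rule tendsto_unique[rotated, symmetric]) simp
qed

lemma eventually_analytic_affine:
  assumes "G analytic_on {p}"
  shows "\<forall>\<^sub>F t in at 0. G analytic_on {p + k * t :: complex}"
proof -
  obtain S where S: "open S" "p \<in> S" "G holomorphic_on S" using assms unfolding analytic_at by blast
  have "((\<lambda>t. p + k * t) \<longlongrightarrow> p) (at 0)" by (auto intro!: tendsto_eq_intros)
  then have "\<forall>\<^sub>F t in at 0. p + k * t \<in> S" using S by (blast dest: topological_tendstoD)
  then show ?thesis by (rule eventually_mono) (use S in \<open>auto simp: analytic_at\<close>)
qed

text \<open>
  The difference equation of \<open>G\<close> for the step up from \<open>b\<close> and for the step up to \<open>b\<close>: shifts
  of a variable in either direction move the arguments of \<open>G\<close> up or down by \<open>\<delta>\<close>.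
\<close>

definition shift_equation :: "(complex \<Rightarrow> complex) \<Rightarrow> complex \<Rightarrow> complex \<Rightarrow> complex \<Rightarrow> bool" where
  "shift_equation G c0 \<delta> b \<longleftrightarrow>
     G (b + \<delta>) = c0 * br b * G b \<and> G b = c0 * br (b - \<delta>) * G (b - \<delta>)"

text \<open>
  A shift of \<open>u\<close> moves all four arguments of \<open>G\<close> the same way, and $c_0$ cancels between numerator
  and denominator. A shift of \<open>v\<close> moves the two arguments of each product in opposite directions, so
  $c_0$ cancels inside the product, and the relation $c+c'=\delta$ exchanges the brackets of \<open>c\<close> and
  of \<open>c'\<close>.
\<close>

lemma kernel_shifts_quotient:
  fixes G :: "complex \<Rightarrow> complex" and \<delta> \<kappa> :: complex
  defines "c \<equiv> (\<delta> - \<kappa>) / 2" and "c' \<equiv> (\<delta> + \<kappa>) / 2"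
  assumes c0: "c0 \<noteq> 0"
    and nz: "\<And>w. w \<in> {c, - c, c', - c'} \<Longrightarrow> pm br u v w \<noteq> 0"
    and shift: "\<And>b. b \<in> {u + v + c, u - v + c, u + v + c', u - v + c'} \<Longrightarrow> shift_equation G c0 \<delta> b"
  shows "kernel_shifts (\<lambda>u v. pm G u v c / pm G u v c') \<delta> \<kappa> (- \<kappa>) u v"
proof -
  note G = shift[unfolded shift_equation_def]
  have cc': "c + c' = \<delta>" by (simp add: c_def c'_def field_simps)
  define g where "g u v = pm G u v c / pm G u v c'" for u v
  have nz1: "pm br (- u) v w \<noteq> 0" "pm br v u w \<noteq> 0" "pm br (- v) u w \<noteq> 0" if "w \<in> {c, c'}" for w
    using pm_br_nonzero_signs[of u v w] nz that by blast+
  have 1: "g (u + \<delta>) v = g u v * (pm br u v c / pm br u v c')"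
  proof -
    have "pm G (u + \<delta>) v a = c0 ^ 2 * pm br u v a * pm G u v a" if "a \<in> {c, c'}" for a
      using G[of "u + v + a"] G[of "u - v + a"] that
      by (auto simp: pm_def power2_eq_square algebra_simps)
    then show ?thesis using c0 by (simp add: g_def mult_ac)
  qed
  have 2: "g (u - \<delta>) v = g u v * (pm br (- u) v c / pm br (- u) v c')"
  proof -
    have "pm G u v a = c0 ^ 2 * pm br (u - \<delta>) v a * pm G (u - \<delta>) v a" if "a \<in> {c, c'}" for a
      using G[of "u + v + a"] G[of "u - v + a"] that
      by (auto simp: pm_def power2_eq_square algebra_simps)
    moreover have "pm br (u - \<delta>) v c = pm br (- u) v c'" "pm br (u - \<delta>) v c' = pm br (- u) v c"
      using pm_shift[of "u - \<delta>" c u "- c'" br v] pm_shift[of "u - \<delta>" c' u "- c" br v]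
        pm_minus[of "- u" v] cc' by (auto simp: algebra_simps)
    ultimately have "g u v = g (u - \<delta>) v * (pm br (- u) v c' / pm br (- u) v c)"
      using c0 by (simp add: g_def mult_ac)
    then show ?thesis using nz1(1) by (simp add: mult_ac)
  qed
  have step: "g u (z + \<delta>) = g u z * (pm br z u c / pm br z u c')" if z: "z \<in> {v, - v}" for z
  proof -
    have *: "pm G u (z + \<delta>) a * br (z - u + b) = - br (z + u + a) * pm G u z a"
      if "(a, b) \<in> {(c, c'), (c', c)}" for a b
    proof -
      have "G (u + z + a + \<delta>) = c0 * br (u + z + a) * G (u + z + a)"
        "G (u - z + a) = c0 * br (u - z + a - \<delta>) * G (u - z + a - \<delta>)"
        using G[of "u + z + a"] G[of "u - z + a"] that z by auto
      moreover have "br (z - u + b) = - br (u - z + a - \<delta>)"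
        unfolding br_minus[symmetric] using that cc' by (auto simp: algebra_simps)
      ultimately show ?thesis by (simp add: pm_def algebra_simps)
    qed
    have "br (z - u + c) \<noteq> 0" "br (z - u + c') \<noteq> 0"
      using nz1(2,3) z by (auto simp: pm_def)
    then have "pm G u (z + \<delta>) c = - br (z + u + c) / br (z - u + c') * pm G u z c"
      "pm G u (z + \<delta>) c' = - br (z + u + c') / br (z - u + c) * pm G u z c'"
      using *[of c c'] *[of c' c] by (simp_all add: field_simps)
    then show ?thesis by (simp add: g_def pm_def mult_ac)
  qed
  have sym: "g a (- b) = g a b" for a b by (simp add: g_def pm_minus_right)
  have "g u (v - \<delta>) = g u v * (pm br (- v) u c / pm br (- v) u c')"
    using step[of "- v"] sym[of u "v - \<delta>"] sym[of u v] by simp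
  moreover have "\<kappa> + (- \<kappa> - \<delta>) / 2 = - c" "(- \<kappa> - \<delta>) / 2 = - c'"
    by (simp_all add: c_def c'_def field_simps)
  moreover have "pm br v u (- a) = pm br (- v) u a" "pm br (- v) u (- a) = pm br v u a" for a
    using pm_minus[of "- v" u a] pm_minus[of v u a] by simp_all
  ultimately have "kernel_shifts g \<delta> \<kappa> (- \<kappa>) u v"
    using 1 2 step[of v] by (simp add: kernel_shifts_def c_def[symmetric] c'_def[symmetric])
  then show ?thesis by (simp add: g_def[abs_def])
qed

text \<open>
  Here the factor is symmetric in \<open>u\<close> and \<open>v\<close> and even in each of them, so one shift relation yields
  the other three.
\<close>

lemma kernel_shifts_product:
  fixes G :: "complex \<Rightarrow> complex" and \<delta> \<kappa> :: complex
  defines "c \<equiv> (\<delta> - \<kappa>) / 2" and "c' \<equiv> (\<delta> + \<kappa>) / 2"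
  assumes c0: "c0 \<noteq> 0"
    and nz: "\<And>w. w \<in> {c', - c'} \<Longrightarrow> pm br u v w \<noteq> 0"
    and shift: "\<And>b. b \<in> {u + v + c, u - v + c, - u + v + c, - u - v + c} \<Longrightarrow> shift_equation G c0 \<delta> b"
  shows "kernel_shifts (\<lambda>u v. pm G u v c * pm G (- u) v c) \<delta> \<kappa> (- \<kappa>) u v"
proof -
  note G = shift[unfolded shift_equation_def]
  have cc': "c - \<delta> = - c'" by (simp add: c_def c'_def field_simps)
  define g where "g u v = pm G u v c * pm G (- u) v c" for u v
  have nz1: "pm br (- u) v c' \<noteq> 0" "pm br v u c' \<noteq> 0" "pm br (- v) u c' \<noteq> 0"
    using pm_br_nonzero_signs[of u v c'] nz by blast+
  have step: "g (a + \<delta>) b = g a b * (pm br a b c / pm br a b c')"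
    if "(a, b) \<in> {(u, v), (- u, v), (v, u), (- v, u)}" for a b
  proof -
    have pts: "{a + b + c, a - b + c, - a + b + c, - a - b + c}
        \<subseteq> {u + v + c, u - v + c, - u + v + c, - u - v + c}"
      using that by (auto simp: algebra_simps)
    have "pm G (a + \<delta>) b c = c0 ^ 2 * pm br a b c * pm G a b c"
      using G[of "a + b + c"] G[of "a - b + c"] pts
      by (simp add: pm_def power2_eq_square algebra_simps)
    moreover have "pm G (- a) b c = c0 ^ 2 * pm br (- a - \<delta>) b c * pm G (- a - \<delta>) b c"
      using G[of "- a + b + c"] G[of "- a - b + c"] pts
      by (simp add: pm_def power2_eq_square algebra_simps)
    moreover have "pm br (- a - \<delta>) b c = pm br a b c'"
      using pm_shift[of "- a - \<delta>" c "- a" "- c'" br b] pm_minus[of a b c'] cc' by (simp add: algebra_simps)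
    moreover have "pm br a b c' \<noteq> 0" using that nz nz1 by auto
    ultimately show ?thesis using c0 by (simp add: g_def mult_ac)
  qed
  have sym: "g (- a) b = g a b" "g a b = g b a" for a b
    by (simp_all add: g_def pm_def algebra_simps)
  have "g (u - \<delta>) v = g u v * (pm br (- u) v c / pm br (- u) v c')"
    using step[of "- u" v] sym(1)[of "u - \<delta>" v] sym(1)[of u v] by simp
  moreover have "g u (v + \<delta>) = g u v * (pm br v u c / pm br v u c')"
    using step[of v u] sym(2)[of u "v + \<delta>"] sym(2)[of u v] by simp
  moreover have "g u (v - \<delta>) = g u v * (pm br (- v) u c / pm br (- v) u c')"
    using step[of "- v" u] sym(2)[of u "v - \<delta>"] sym(2)[of u v] sym(1)[of "v - \<delta>" u] sym(1)[of v u] by simp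
  moreover have "\<kappa> + (- \<kappa> - \<delta>) / 2 = - c" "(- \<kappa> - \<delta>) / 2 = - c'"
    by (simp_all add: c_def c'_def field_simps)
  moreover have "pm br v u (- a) = pm br (- v) u a" "pm br (- v) u (- a) = pm br v u a" for a
    using pm_minus[of "- v" u a] pm_minus[of v u a] by simp_all
  ultimately have "kernel_shifts g \<delta> \<kappa> (- \<kappa>) u v"
    using step[of u v] by (simp add: kernel_shifts_def c_def[symmetric] c'_def[symmetric])
  then show ?thesis by (simp add: g_def[abs_def])
qed

lemma eventually_shift_equation:
  assumes G: "\<forall>\<^sub>\<approx>u\<in>UNIV. G (u + \<delta>) = c0 * br u * G u"
    and an: "G analytic_on {b - \<delta>}" "G analytic_on {b}" "G analytic_on {b + \<delta>}"
  shows "\<forall>\<^sub>F t in at 0. shift_equation G c0 \<delta> (b + k * t)"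
  using an[THEN eventually_analytic_affine, of k]
proof eventually_elim
  case (elim t)
  have eq: "b - \<delta> + k * t = b + k * t - \<delta>" "b + \<delta> + k * t = b + k * t + \<delta>" by simp_all
  show ?case
    using functional_equation_at[OF G, of "b + k * t"] functional_equation_at[OF G, of "b + k * t - \<delta>"]
      elim unfolding eq shift_equation_def by simp
qed

lemma isCont_pm_affine:
  fixes G :: "complex \<Rightarrow> complex"
  assumes "G analytic_on {u + v + c}" "G analytic_on {u - v + c}"
  shows "isCont (\<lambda>t. pm G (u + a * t) (v + b * t) c) 0"
  unfolding pm_def
  by (intro continuous_intros isCont_o2[where f = "\<lambda>t. u + a * t + (v + b * t) + c" and g = G]
      isCont_o2[where f = "\<lambda>t. u + a * t - (v + b * t) + c" and g = G] analytic_at_imp_isCont)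
     (simp_all add: assms)

lemma on_shifts_entries:
  assumes "on_shifts \<delta> m n (\<lambda>x y. \<forall>j\<in>{1..m}. \<forall>l\<in>{1..n}. Q (x j) (y l)) x y"
    and "i \<in> {1..m}" "l \<in> {1..n}"
    and "(u, v) \<in> {(x i, y l), (x i + \<delta>, y l), (x i - \<delta>, y l), (x i, y l + \<delta>), (x i, y l - \<delta>)}"
  shows "Q u v"
proof -
  have "Q (x i) (y l)" "Q ((x(i := x i + \<delta>)) i) (y l)" "Q ((x(i := x i - \<delta>)) i) (y l)"
    "Q (x i) ((y(l := y l + \<delta>)) l)" "Q (x i) ((y(l := y l - \<delta>)) l)"
    using assms(1-3) unfolding on_shifts_def by blast+
  then show ?thesis using assms(4) by auto
qed

text \<open>
  The value $\epsilon=-\kappa$. It turns $\delta'$ into $-\delta$ and $\mu'$ into $-\nu$, so that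
  reflecting the \<open>y\<close>-operator leaves both operators with the parameters \<open>\<delta>\<close> and \<open>\<kappa>\<close>; the
  minus sign between them comes from $[-\kappa]=-[\kappa]$.
\<close>

lemma kernel_identity_common_step:
  fixes g :: "complex \<Rightarrow> complex \<Rightarrow> complex" and m n :: nat
  defines "F \<equiv> \<lambda>x y. \<Prod>j=1..m. \<Prod>l=1..n. g (x j) (y l)"
  assumes x: "BC_regular \<rho> \<omega> br \<delta> m x" and y: "BC_regular \<rho> \<omega> br \<delta> n y"
    and \<kappa>: "br \<kappa> \<noteq> 0" and d: "br (\<kappa> - \<delta>) \<noteq> 0"
    and \<nu>: "\<And>s. s \<in> {1..2*\<rho>} \<Longrightarrow> \<nu> s = (\<delta> + \<kappa>) / 2 - \<mu> s"
    and g: "\<And>i l. i \<in> {1..m} \<Longrightarrow> l \<in> {1..n} \<Longrightarrow>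
        \<forall>\<^sub>F t in at 0. kernel_shifts g \<delta> \<kappa> (- \<kappa>) (x i + t) (y l + 2 * t)"
    and cont: "\<And>i l u v. i \<in> {1..m} \<Longrightarrow> l \<in> {1..n} \<Longrightarrow>
        (u, v) \<in> {(x i, y l), (x i + \<delta>, y l), (x i - \<delta>, y l), (x i, y l + \<delta>), (x i, y l - \<delta>)} \<Longrightarrow>
        isCont (\<lambda>t. g (u + t) (v + 2 * t)) 0"
  shows "br \<kappa> * ruijsenaars_BC \<rho> \<omega> br \<mu> \<delta> \<kappa> m (\<lambda>x. F x y) x - br \<kappa> * ruijsenaars_BC \<rho> \<omega> br \<nu> \<delta> \<kappa> n (F x) y
       = br (2 * (of_nat m - of_nat n) * \<kappa> + c_const \<rho> \<omega> \<mu> \<delta> \<kappa>) * F x y"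
proof -
  have y': "BC_regular \<rho> \<omega> br (- \<delta>) n y" using y unfolding BC_regular_iff by auto
  have "br \<kappa> * ruijsenaars_BC \<rho> \<omega> br \<mu> \<delta> \<kappa> m (\<lambda>x. F x y) x
      + br (- \<kappa>) * ruijsenaars_BC \<rho> \<omega> br (\<lambda>s. - \<nu> s) (- \<delta>) (- \<kappa>) n (F x) y
    = br (2 * of_nat m * \<kappa> + 2 * of_nat n * (- \<kappa>) + c_const \<rho> \<omega> \<mu> \<delta> \<kappa>) * F x y"
    unfolding F_def
  proof (rule kernel_identity[OF x y' \<kappa> _ d _ _ g])
    show "br (- \<kappa>) \<noteq> 0" using \<kappa> by (simp add: br_minus)
    show "- \<nu> s = \<mu> s + (- \<kappa> - \<delta>) / 2" if "s \<in> {1..2*\<rho>}" for s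
      using \<nu>[OF that] by (simp add: field_simps)
    show "- \<delta> = - \<kappa> + \<kappa> - \<delta>" by simp
    fix i l u v assume "i \<in> {1..m}" "l \<in> {1..n}"
      "(u, v) \<in> {(x i, y l), (x i + \<delta>, y l), (x i - \<delta>, y l), (x i, y l + - \<delta>), (x i, y l - - \<delta>)}"
    then show "isCont (\<lambda>t. g (u + t) (v + 2 * t)) 0" by (intro cont[of i l u v]) auto
  qed auto
  moreover have "ruijsenaars_BC \<rho> \<omega> br (\<lambda>s. - \<nu> s) (- \<delta>) (- \<kappa>) n (F x) y
      = ruijsenaars_BC \<rho> \<omega> br \<nu> \<delta> \<kappa> n (F x) y"
    by (rule ruijsenaars_BC_reflect) simp
  ultimately show ?thesis by (simp add: br_minus algebra_simps)
qed

lemma kernel_identity_quot: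
  assumes c0: "c0 \<noteq> 0" and G: "\<forall>\<^sub>\<approx>u\<in>UNIV. G (u + \<delta>) = c0 * br u * G u"
    and \<kappa>: "br \<kappa> \<noteq> 0" and d: "br (\<kappa> - \<delta>) \<noteq> 0"
    and \<nu>: "\<forall>r\<in>{1..2*\<rho>}. \<nu> r = (\<delta> + \<kappa>) / 2 - \<mu> r"
    and x: "BC_regular \<rho> \<omega> br \<delta> m x" and y: "BC_regular \<rho> \<omega> br \<delta> n y"
    and reg: "on_shifts \<delta> m n (Phi_BC_quot_regular G \<delta> \<kappa> m n) x y"
  shows "br \<kappa> * ruijsenaars_BC \<rho> \<omega> br \<mu> \<delta> \<kappa> m (\<lambda>x. Phi_BC_quot G \<delta> \<kappa> m n x y) x
       - br \<kappa> * ruijsenaars_BC \<rho> \<omega> br \<nu> \<delta> \<kappa> n (\<lambda>y. Phi_BC_quot G \<delta> \<kappa> m n x y) y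
       = br (2 * (of_nat m - of_nat n) * \<kappa> + c_const \<rho> \<omega> \<mu> \<delta> \<kappa>) * Phi_BC_quot G \<delta> \<kappa> m n x y"
proof -
  define Q where "Q u v \<longleftrightarrow> (\<forall>\<epsilon>\<in>{1, -1}.
      G analytic_on {u + \<epsilon> * v + (\<delta> - \<kappa>) / 2} \<and>
      G analytic_on {u + \<epsilon> * v + (\<delta> + \<kappa>) / 2} \<and>
      G (u + \<epsilon> * v + (\<delta> + \<kappa>) / 2) \<noteq> 0)" for u v
  have Q: "Q u v" if "i \<in> {1..m}" "l \<in> {1..n}"
    "(u, v) \<in> {(x i, y l), (x i + \<delta>, y l), (x i - \<delta>, y l), (x i, y l + \<delta>), (x i, y l - \<delta>)}" for i l u v
    using on_shifts_entries[of \<delta> m n Q x y i l u v] reg that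
    unfolding Phi_BC_quot_regular_def[abs_def] Q_def by blast
  show ?thesis
    unfolding Phi_BC_quot_def
  proof (rule kernel_identity_common_step[OF x y \<kappa> d])
    show "\<nu> s = (\<delta> + \<kappa>) / 2 - \<mu> s" if "s \<in> {1..2*\<rho>}" for s using \<nu> that by blast
  next
    fix i l assume il: "i \<in> {1..m}" "l \<in> {1..n}"
    have an: "G analytic_on {x i + \<epsilon> * y l + a - \<delta>}" "G analytic_on {x i + \<epsilon> * y l + a}"
      "G analytic_on {x i + \<epsilon> * y l + a + \<delta>}"
      if "\<epsilon> \<in> {1, -1}" "a \<in> {(\<delta> - \<kappa>) / 2, (\<delta> + \<kappa>) / 2}" for \<epsilon> a
    proof -
      have eq: "x i + \<epsilon> * y l + a - \<delta> = (x i - \<delta>) + \<epsilon> * y l + a"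
        "x i + \<epsilon> * y l + a + \<delta> = (x i + \<delta>) + \<epsilon> * y l + a" by simp_all
      have "Q (x i - \<delta>) (y l)" "Q (x i) (y l)" "Q (x i + \<delta>) (y l)" by (intro Q[OF il]; simp)+
      then show "G analytic_on {x i + \<epsilon> * y l + a - \<delta>}" "G analytic_on {x i + \<epsilon> * y l + a}"
        "G analytic_on {x i + \<epsilon> * y l + a + \<delta>}"
        using that unfolding eq Q_def by blast+
    qed
    have "\<forall>\<^sub>F t in at 0. \<forall>\<epsilon>\<in>{1, -1}. \<forall>a\<in>{(\<delta> - \<kappa>) / 2, (\<delta> + \<kappa>) / 2}.
        shift_equation G c0 \<delta> (x i + \<epsilon> * y l + a + (1 + 2 * \<epsilon>) * t)"
      by (intro eventually_ball_finite ballI eventually_shift_equation[OF G] an) auto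
    moreover have "\<forall>\<^sub>F t in at 0. \<forall>w\<in>{(\<delta> - \<kappa>) / 2, - ((\<delta> - \<kappa>) / 2), (\<delta> + \<kappa>) / 2, - ((\<delta> + \<kappa>) / 2)}.
        pm br (x i + 1 * t) (y l + 2 * t) w \<noteq> 0"
      by (intro eventually_ball_finite ballI eventually_pm_br_nonzero) auto
    ultimately show "\<forall>\<^sub>F t in at 0. kernel_shifts
        (\<lambda>u v. pm G u v ((\<delta> - \<kappa>) / 2) / pm G u v ((\<delta> + \<kappa>) / 2)) \<delta> \<kappa> (- \<kappa>) (x i + t) (y l + 2 * t)"
    proof eventually_elim
      case (elim t)
      have pts: "x i + t + (y l + 2 * t) + a = x i + 1 * y l + a + (1 + 2 * 1) * t"
        "x i + t - (y l + 2 * t) + a = x i + (- 1) * y l + a + (1 + 2 * (- 1)) * t" for a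
        by (simp_all add: algebra_simps)
      show ?case
      proof (rule kernel_shifts_quotient[OF c0])
        show "pm br (x i + t) (y l + 2 * t) w \<noteq> 0"
          if "w \<in> {(\<delta> - \<kappa>) / 2, - ((\<delta> - \<kappa>) / 2), (\<delta> + \<kappa>) / 2, - ((\<delta> + \<kappa>) / 2)}" for w
          using bspec[OF elim(2) that] by simp
      next
        fix b assume "b \<in> {x i + t + (y l + 2 * t) + (\<delta> - \<kappa>) / 2, x i + t - (y l + 2 * t) + (\<delta> - \<kappa>) / 2,
            x i + t + (y l + 2 * t) + (\<delta> + \<kappa>) / 2, x i + t - (y l + 2 * t) + (\<delta> + \<kappa>) / 2}"
        then obtain \<epsilon> a where "\<epsilon> \<in> {1, -1}" "a \<in> {(\<delta> - \<kappa>) / 2, (\<delta> + \<kappa>) / 2}"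
          "b = x i + \<epsilon> * y l + a + (1 + 2 * \<epsilon>) * t"
          unfolding pts by blast
        then show "shift_equation G c0 \<delta> b"
          using elim(1) by blast
      qed
    qed
  next
    fix i l u v assume *: "i \<in> {1..m}" "l \<in> {1..n}"
      "(u, v) \<in> {(x i, y l), (x i + \<delta>, y l), (x i - \<delta>, y l), (x i, y l + \<delta>), (x i, y l - \<delta>)}"
    have "Q u v" by (rule Q[OF *])
    then show "isCont (\<lambda>t. pm G (u + t) (v + 2 * t) ((\<delta> - \<kappa>) / 2) / pm G (u + t) (v + 2 * t) ((\<delta> + \<kappa>) / 2)) 0"
      using isCont_pm_affine[of G u v "(\<delta> - \<kappa>) / 2" 1 2] isCont_pm_affine[of G u v "(\<delta> + \<kappa>) / 2" 1 2]
      unfolding Q_def by (intro continuous_intros) (simp_all add: pm_def)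
  qed
qed

lemma kernel_identity_prod:
  assumes c0: "c0 \<noteq> 0" and G: "\<forall>\<^sub>\<approx>u\<in>UNIV. G (u + \<delta>) = c0 * br u * G u"
    and \<kappa>: "br \<kappa> \<noteq> 0" and d: "br (\<kappa> - \<delta>) \<noteq> 0"
    and \<nu>: "\<forall>r\<in>{1..2*\<rho>}. \<nu> r = (\<delta> + \<kappa>) / 2 - \<mu> r"
    and x: "BC_regular \<rho> \<omega> br \<delta> m x" and y: "BC_regular \<rho> \<omega> br \<delta> n y"
    and reg: "on_shifts \<delta> m n (Phi_BC_prod_regular G \<delta> \<kappa> m n) x y"
  shows "br \<kappa> * ruijsenaars_BC \<rho> \<omega> br \<mu> \<delta> \<kappa> m (\<lambda>x. Phi_BC_prod G \<delta> \<kappa> m n x y) x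
       - br \<kappa> * ruijsenaars_BC \<rho> \<omega> br \<nu> \<delta> \<kappa> n (\<lambda>y. Phi_BC_prod G \<delta> \<kappa> m n x y) y
       = br (2 * (of_nat m - of_nat n) * \<kappa> + c_const \<rho> \<omega> \<mu> \<delta> \<kappa>) * Phi_BC_prod G \<delta> \<kappa> m n x y"
proof -
  define Q where "Q u v \<longleftrightarrow> (\<forall>\<epsilon>\<^sub>1\<in>{1, -1}. \<forall>\<epsilon>\<^sub>2\<in>{1, -1}.
      G analytic_on {\<epsilon>\<^sub>1 * u + \<epsilon>\<^sub>2 * v + (\<delta> - \<kappa>) / 2})" for u v
  have Q: "Q u v" if "i \<in> {1..m}" "l \<in> {1..n}"
    "(u, v) \<in> {(x i, y l), (x i + \<delta>, y l), (x i - \<delta>, y l), (x i, y l + \<delta>), (x i, y l - \<delta>)}" for i l u v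
    using on_shifts_entries[of \<delta> m n Q x y i l u v] reg that
    unfolding Phi_BC_prod_regular_def[abs_def] Q_def by blast
  have signs: "(\<Prod>\<epsilon>\<^sub>1\<in>{1, -1}. \<Prod>\<epsilon>\<^sub>2\<in>{1, -1}. G (\<epsilon>\<^sub>1 * u + \<epsilon>\<^sub>2 * v + (\<delta> - \<kappa>) / 2))
      = pm G u v ((\<delta> - \<kappa>) / 2) * pm G (- u) v ((\<delta> - \<kappa>) / 2)" for u v
    by (simp add: pm_def)
  show ?thesis
    unfolding Phi_BC_prod_def signs
  proof (rule kernel_identity_common_step[OF x y \<kappa> d])
    show "\<nu> s = (\<delta> + \<kappa>) / 2 - \<mu> s" if "s \<in> {1..2*\<rho>}" for s using \<nu> that by blast
  next
    fix i l assume il: "i \<in> {1..m}" "l \<in> {1..n}"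
    have an: "G analytic_on {\<epsilon>\<^sub>1 * x i + \<epsilon>\<^sub>2 * y l + (\<delta> - \<kappa>) / 2 - \<delta>}"
      "G analytic_on {\<epsilon>\<^sub>1 * x i + \<epsilon>\<^sub>2 * y l + (\<delta> - \<kappa>) / 2}"
      "G analytic_on {\<epsilon>\<^sub>1 * x i + \<epsilon>\<^sub>2 * y l + (\<delta> - \<kappa>) / 2 + \<delta>}"
      if "\<epsilon>\<^sub>1 \<in> {1, -1}" "\<epsilon>\<^sub>2 \<in> {1, -1}" for \<epsilon>\<^sub>1 \<epsilon>\<^sub>2
    proof -
      have *: "G analytic_on {\<epsilon>\<^sub>1 * x i + \<epsilon>\<^sub>2 * y l + (\<delta> - \<kappa>) / 2 + s}" if "s \<in> {0, \<delta>, - \<delta>}" for s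
      proof -
        have eq: "\<epsilon>\<^sub>1 * x i + \<epsilon>\<^sub>2 * y l + (\<delta> - \<kappa>) / 2 + s
            = \<epsilon>\<^sub>1 * (x i + \<epsilon>\<^sub>1 * s) + \<epsilon>\<^sub>2 * y l + (\<delta> - \<kappa>) / 2"
          using \<open>\<epsilon>\<^sub>1 \<in> {1, -1}\<close> by (auto simp: algebra_simps)
        have "Q (x i + \<epsilon>\<^sub>1 * s) (y l)"
          using \<open>\<epsilon>\<^sub>1 \<in> {1, -1}\<close> that by (intro Q[OF il]) auto
        then show ?thesis
          using \<open>\<epsilon>\<^sub>1 \<in> {1, -1}\<close> \<open>\<epsilon>\<^sub>2 \<in> {1, -1}\<close> unfolding eq Q_def by blast
      qed
      show "G analytic_on {\<epsilon>\<^sub>1 * x i + \<epsilon>\<^sub>2 * y l + (\<delta> - \<kappa>) / 2 - \<delta>}"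
        "G analytic_on {\<epsilon>\<^sub>1 * x i + \<epsilon>\<^sub>2 * y l + (\<delta> - \<kappa>) / 2}"
        "G analytic_on {\<epsilon>\<^sub>1 * x i + \<epsilon>\<^sub>2 * y l + (\<delta> - \<kappa>) / 2 + \<delta>}"
        using *[of "- \<delta>"] *[of 0] *[of \<delta>] by simp_all
    qed
    have "\<forall>\<^sub>F t in at 0. \<forall>\<epsilon>\<^sub>1\<in>{1, -1}. \<forall>\<epsilon>\<^sub>2\<in>{1, -1}.
        shift_equation G c0 \<delta> (\<epsilon>\<^sub>1 * x i + \<epsilon>\<^sub>2 * y l + (\<delta> - \<kappa>) / 2 + (\<epsilon>\<^sub>1 + 2 * \<epsilon>\<^sub>2) * t)"
      by (intro eventually_ball_finite ballI eventually_shift_equation[OF G] an) auto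
    moreover have "\<forall>\<^sub>F t in at 0. \<forall>w\<in>{(\<delta> + \<kappa>) / 2, - ((\<delta> + \<kappa>) / 2)}.
        pm br (x i + 1 * t) (y l + 2 * t) w \<noteq> 0"
      by (intro eventually_ball_finite ballI eventually_pm_br_nonzero) auto
    ultimately show "\<forall>\<^sub>F t in at 0. kernel_shifts
        (\<lambda>u v. pm G u v ((\<delta> - \<kappa>) / 2) * pm G (- u) v ((\<delta> - \<kappa>) / 2)) \<delta> \<kappa> (- \<kappa>) (x i + t) (y l + 2 * t)"
    proof eventually_elim
      case (elim t)
      have pts:
        "x i + t + (y l + 2 * t) + a = 1 * x i + 1 * y l + a + (1 + 2 * 1) * t"
        "x i + t - (y l + 2 * t) + a = 1 * x i + (- 1) * y l + a + (1 + 2 * (- 1)) * t"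
        "- (x i + t) + (y l + 2 * t) + a = (- 1) * x i + 1 * y l + a + (- 1 + 2 * 1) * t"
        "- (x i + t) - (y l + 2 * t) + a = (- 1) * x i + (- 1) * y l + a + (- 1 + 2 * (- 1)) * t" for a
        by (simp_all add: algebra_simps)
      show ?case
      proof (rule kernel_shifts_product[OF c0])
        show "pm br (x i + t) (y l + 2 * t) w \<noteq> 0" if "w \<in> {(\<delta> + \<kappa>) / 2, - ((\<delta> + \<kappa>) / 2)}" for w
          using bspec[OF elim(2) that] by simp
      next
        fix b assume "b \<in> {x i + t + (y l + 2 * t) + (\<delta> - \<kappa>) / 2, x i + t - (y l + 2 * t) + (\<delta> - \<kappa>) / 2,
            - (x i + t) + (y l + 2 * t) + (\<delta> - \<kappa>) / 2, - (x i + t) - (y l + 2 * t) + (\<delta> - \<kappa>) / 2}"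
        then obtain \<epsilon>\<^sub>1 \<epsilon>\<^sub>2 where "\<epsilon>\<^sub>1 \<in> {1, -1}" "\<epsilon>\<^sub>2 \<in> {1, -1}"
          "b = \<epsilon>\<^sub>1 * x i + \<epsilon>\<^sub>2 * y l + (\<delta> - \<kappa>) / 2 + (\<epsilon>\<^sub>1 + 2 * \<epsilon>\<^sub>2) * t"
          unfolding pts by blast
        then show "shift_equation G c0 \<delta> b"
          using elim(1) by blast
      qed
    qed
  next
    fix i l u v assume *: "i \<in> {1..m}" "l \<in> {1..n}"
      "(u, v) \<in> {(x i, y l), (x i + \<delta>, y l), (x i - \<delta>, y l), (x i, y l + \<delta>), (x i, y l - \<delta>)}"
    have "Q u v" by (rule Q[OF *])
    then show "isCont (\<lambda>t. pm G (u + t) (v + 2 * t) ((\<delta> - \<kappa>) / 2) * pm G (- (u + t)) (v + 2 * t) ((\<delta> - \<kappa>) / 2)) 0"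
      using isCont_pm_affine[of G u v "(\<delta> - \<kappa>) / 2" 1 2] isCont_pm_affine[of G "- u" v "(\<delta> - \<kappa>) / 2" "- 1" 2]
      unfolding Q_def by (intro continuous_intros) simp_all
  qed
qed

lemma kernel_identity_bracket:
  assumes "br \<delta> \<noteq> 0" "br \<kappa> \<noteq> 0" "br (\<kappa> - \<delta>) \<noteq> 0"
    and "BC_regular \<rho> \<omega> br \<delta> m x" "BC_regular \<rho> \<omega> br \<kappa> n y"
  shows "br \<kappa> * ruijsenaars_BC \<rho> \<omega> br \<mu> \<delta> \<kappa> m (\<lambda>x. Psi_BC br m n x y) x
       + br \<delta> * ruijsenaars_BC \<rho> \<omega> br \<mu> \<kappa> \<delta> n (\<lambda>y. Psi_BC br m n x y) y
       = br (2 * of_nat m * \<kappa> + 2 * of_nat n * \<delta> + c_const \<rho> \<omega> \<mu> \<delta> \<kappa>) * Psi_BC br m n x y"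
    unfolding Psi_BC_def
  proof (rule kernel_identity[OF assms(4,5,2,1,3)])
    show "\<forall>\<^sub>F t in at 0. kernel_shifts (\<lambda>u v. pm br u v 0) \<delta> \<kappa> \<delta> (x i + t) (y l + 2 * t)" for i l
    proof -
      have "\<forall>\<^sub>F t in at 0. pm br (x i + 1 * t) (y l + 2 * t) 0 \<noteq> 0"
        by (rule eventually_pm_br_nonzero) auto
      then show ?thesis by eventually_elim (simp add: kernel_shifts_bracket)
    qed
  qed (auto intro!: continuous_intros)

end

theorem theorem2p4:
  fixes br :: "complex \<Rightarrow> complex" and \<rho> :: nat and \<omega> :: "nat \<Rightarrow> complex"
    and \<delta> \<kappa> :: complex and \<mu> :: "nat \<Rightarrow> complex" and m n :: nat
  assumes "bracket_data \<rho> \<omega> br"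
    and "\<delta> \<notin> zero_set br" and "\<kappa> \<notin> zero_set br" and "\<kappa> - \<delta> \<notin> zero_set br"
  shows
    "(\<forall>(G :: complex \<Rightarrow> complex) (c0 :: complex) (\<nu> :: nat \<Rightarrow> complex).
        G meromorphic_on UNIV \<longrightarrow> \<not> (\<forall>\<^sub>\<approx>u\<in>UNIV. G u = 0) \<longrightarrow>
        c0 \<noteq> 0 \<longrightarrow> (\<forall>\<^sub>\<approx>u\<in>UNIV. G (u + \<delta>) = c0 * br u * G u) \<longrightarrow>
        (\<forall>r\<in>{1..2*\<rho>}. \<nu> r = (\<delta> + \<kappa>) / 2 - \<mu> r) \<longrightarrow>
        (\<forall>x y. BC_regular \<rho> \<omega> br \<delta> m x \<longrightarrow> BC_regular \<rho> \<omega> br \<delta> n y \<longrightarrow>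
           on_shifts \<delta> m n (Phi_BC_quot_regular G \<delta> \<kappa> m n) x y \<longrightarrow>
           br \<kappa> * ruijsenaars_BC \<rho> \<omega> br \<mu> \<delta> \<kappa> m (\<lambda>x. Phi_BC_quot G \<delta> \<kappa> m n x y) x
           - br \<kappa> * ruijsenaars_BC \<rho> \<omega> br \<nu> \<delta> \<kappa> n (\<lambda>y. Phi_BC_quot G \<delta> \<kappa> m n x y) y
           = br (2 * (of_nat m - of_nat n) * \<kappa> + c_const \<rho> \<omega> \<mu> \<delta> \<kappa>)
             * Phi_BC_quot G \<delta> \<kappa> m n x y) \<and>
        (\<forall>x y. BC_regular \<rho> \<omega> br \<delta> m x \<longrightarrow> BC_regular \<rho> \<omega> br \<delta> n y \<longrightarrow>
           on_shifts \<delta> m n (Phi_BC_prod_regular G \<delta> \<kappa> m n) x y \<longrightarrow>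
           br \<kappa> * ruijsenaars_BC \<rho> \<omega> br \<mu> \<delta> \<kappa> m (\<lambda>x. Phi_BC_prod G \<delta> \<kappa> m n x y) x
           - br \<kappa> * ruijsenaars_BC \<rho> \<omega> br \<nu> \<delta> \<kappa> n (\<lambda>y. Phi_BC_prod G \<delta> \<kappa> m n x y) y
           = br (2 * (of_nat m - of_nat n) * \<kappa> + c_const \<rho> \<omega> \<mu> \<delta> \<kappa>)
             * Phi_BC_prod G \<delta> \<kappa> m n x y))
     \<and>
     (\<forall>x y. BC_regular \<rho> \<omega> br \<delta> m x \<longrightarrow> BC_regular \<rho> \<omega> br \<kappa> n y \<longrightarrow>
        br \<kappa> * ruijsenaars_BC \<rho> \<omega> br \<mu> \<delta> \<kappa> m (\<lambda>x. Psi_BC br m n x y) x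
        + br \<delta> * ruijsenaars_BC \<rho> \<omega> br \<mu> \<kappa> \<delta> n (\<lambda>y. Psi_BC br m n x y) y
        = br (2 * of_nat m * \<kappa> + 2 * of_nat n * \<delta> + c_const \<rho> \<omega> \<mu> \<delta> \<kappa>)
          * Psi_BC br m n x y)"
proof -
  interpret bracket \<rho> \<omega> br by (rule bracket_data_imp_bracket[OF assms(1)])
  have nz: "br \<delta> \<noteq> 0" "br \<kappa> \<noteq> 0" "br (\<kappa> - \<delta>) \<noteq> 0"
    using assms(2-4) by (simp_all add: zero_set_def)
  show ?thesis
    by (intro conjI allI impI kernel_identity_quot[OF _ _ nz(2,3)] kernel_identity_prod[OF _ _ nz(2,3)]
        kernel_identity_bracket[OF nz]; assumption)
qed

end
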